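(* For every integer $r\ge 2$ there exist a constant $c_r>0$ and $n_0$ such that for all $n\ge n_0$, $$t^{(r)}(n)\ge c_r\, n^{\frac{3}{5}\cdot\frac{1}{2^{r-1}-1}},$$ i.e. $t^{(r)}(n)=\Omega\left(n^{\frac{3}{5}\cdot\frac{1}{2^{r-1}-1}}\right)$.
   Context: An ordered $r$-matching of size $n$ is an $r$-uniform hypergraph on a linearly ordered vertex set $V$ with $|V|=rn$, consisting of $n$ pairwise disjoint edges. Two ordered matchings are isomorphic if there is an order-preserving bijection between their vertex sets inducing a bijection between their edge sets. A pair of twins in an ordered matching $M$ is a pair of vertex-disjoint sub-matchings of $M$ that are isomorphic as ordered matchings; its size is the number of edges of one of them. $t(M)$ is the maximum size of twins in $M$, and $t^{(r)}(n)=\min\{t(M): M \text{ an ordered } r\text{-matching of size } n\}$. *)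

theory Defs
  imports "HOL-Analysis.Analysis"
begin

text \<open>
  An ordered matching is represented by its set of edges.  Its vertex set is the union of the edges:
  \<open>n\<close> pairwise disjoint \<open>r\<close>-element edges in a vertex set of size \<open>r * n\<close> necessarily cover that set.
  Sub-matchings are then just subsets of the edge set.
\<close>

definition ordered_matching :: "nat \<Rightarrow> nat \<Rightarrow> 'a::linorder set set \<Rightarrow> bool" where
  "ordered_matching r n M \<longleftrightarrow>
     finite M \<and> card M = n \<and> (\<forall>e\<in>M. finite e \<and> card e = r) \<and> pairwise disjnt M"

definition isomorphic_matchings :: "'a::linorder set set \<Rightarrow> 'b::linorder set set \<Rightarrow> bool" where
  "isomorphic_matchings A B \<longleftrightarrow>
     (\<exists>f. bij_betw f (\<Union>A) (\<Union>B) \<and> strict_mono_on (\<Union>A) f \<and> bij_betw ((`) f) A B)"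

definition twins :: "'a::linorder set set \<Rightarrow> 'a set set \<Rightarrow> 'a set set \<Rightarrow> bool" where
  "twins M A B \<longleftrightarrow> A \<subseteq> M \<and> B \<subseteq> M \<and> \<Union>A \<inter> \<Union>B = {} \<and> isomorphic_matchings A B"

definition max_twins :: "'a::linorder set set \<Rightarrow> nat" where
  "max_twins M = Max {card A | A B. twins M A B}"

text \<open>
  The minimum is taken over matchings whose vertices are natural numbers.  Every finite linear order
  embeds into the natural numbers, so this loses nothing; see \<open>min_max_twins_le\<close> below.
\<close>

definition min_max_twins :: "nat \<Rightarrow> nat \<Rightarrow> nat" where
  "min_max_twins r n = Min {max_twins M | M :: nat set set. ordered_matching r n M}"

lemma twins_empty: "twins M {} {}"
  by (auto simp: twins_def isomorphic_matchings_def strict_mono_on_def)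

lemma finite_twin_sizes:
  assumes "finite M"
  shows "finite {card A | A B. twins M A B}"
  by (rule finite_subset[of _ "card ` Pow M"]) (use assms in \<open>auto simp: twins_def\<close>)

lemma max_twins_attained:
  assumes "finite M"
  obtains A B where "twins M A B" "card A = max_twins M"
proof -
  have "max_twins M \<in> {card A | A B. twins M A B}"
    unfolding max_twins_def
    by (rule Max_in[OF finite_twin_sizes[OF assms]]) (use twins_empty in blast)
  then show thesis using that by auto
qed

lemma card_le_max_twins:
  assumes "finite M" "twins M A B"
  shows "card A \<le> max_twins M"
  unfolding max_twins_def
  by (rule Max_ge[OF finite_twin_sizes[OF assms(1)]]) (use assms(2) in blast)

lemma finite_max_twins_values:
  "finite {max_twins M | M :: nat set set. ordered_matching r n M}"
proof (rule finite_subset[of _ "{..n}"])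
  show "{max_twins M | M :: nat set set. ordered_matching r n M} \<subseteq> {..n}"
  proof clarsimp
    fix M :: "nat set set" assume M: "ordered_matching r n M"
    then have fin: "finite M" and n: "card M = n" by (auto simp: ordered_matching_def)
    obtain A B where "twins M A B" "card A = max_twins M" using max_twins_attained[OF fin] .
    then show "max_twins M \<le> n" using fin n card_mono[of M A] by (auto simp: twins_def)
  qed
qed simp

lemma ordered_matching_exists:
  assumes "r > 0"
  shows "\<exists>M :: nat set set. ordered_matching r n M"
proof -
  let ?e = "\<lambda>i. {i * r..<Suc i * r}"
  have disj: "disjnt (?e i) (?e j)" if "i < j" for i j
  proof -
    have "Suc i * r \<le> j * r" using that by (intro mult_right_mono) auto
    then show ?thesis by (auto simp: disjnt_def)
  qed
  have disj': "disjnt (?e i) (?e j)" if "i \<noteq> j" for i j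
    using that disj[of i j] disj[of j i] disjnt_sym by (metis nat_neq_iff)
  have ne: "?e i \<noteq> {}" for i using assms by simp
  have inj: "inj_on ?e {..<n}"
    using disj' ne by (metis (no_types, lifting) disjnt_self_iff_empty inj_onI)
  have "pairwise disjnt (?e ` {..<n})"
  proof (rule pairwiseI)
    fix d e assume "d \<in> ?e ` {..<n}" "e \<in> ?e ` {..<n}" and ne: "d \<noteq> e"
    then obtain i j where ij: "d = ?e i" "e = ?e j" by blast
    with ne have "i \<noteq> j" by blast
    then show "disjnt d e" unfolding ij by (rule disj')
  qed
  then have "ordered_matching r n (?e ` {..<n})"
    using card_image[OF inj] by (auto simp: ordered_matching_def)
  then show ?thesis by blast
qed

lemma min_max_twins_le:
  fixes M :: "'a::linorder set set"
  assumes M: "ordered_matching r n M"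
  shows "min_max_twins r n \<le> max_twins M"
proof -
  let ?V = "\<Union>M"
  define g where "g x = card {y\<in>?V. y < x}" for x
  have finM: "finite M" and finV: "finite ?V" using M by (auto simp: ordered_matching_def)
  have mono: "strict_mono_on ?V g"
  proof (rule strict_mono_onI)
    fix x y assume xy: "x \<in> ?V" "y \<in> ?V" "x < y"
    then have "{z\<in>?V. z < x} \<subset> {z\<in>?V. z < y}" by (intro psubsetI) (auto dest: less_trans simp del: Union_iff)
    moreover have "finite {z\<in>?V. z < y}" by (rule finite_subset[OF _ finV]) blast
    ultimately show "g x < g y" unfolding g_def by (intro psubset_card_mono)
  qed
  have inj: "inj_on g ?V" using mono by (rule strict_mono_on_imp_inj_on)
  have injI: "inj_on ((`) g) M"
    by (rule inj_onI) (use inj in \<open>metis Sup_upper inj_on_image_eq_iff\<close>)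
  define N where "N = (`) g ` M"
  have "ordered_matching r n N"
    unfolding ordered_matching_def N_def
  proof (intro conjI ballI)
    show "finite ((`) g ` M)" using finM by simp
    show "card ((`) g ` M) = n" using card_image[OF injI] M by (simp add: ordered_matching_def)
    show "pairwise disjnt ((`) g ` M)"
    proof (rule pairwiseI, clarify)
      fix d e assume de: "d \<in> M" "e \<in> M" "g ` d \<noteq> g ` e"
      then have "d \<noteq> e" by blast
      with de M have "disjnt d e" by (simp add: ordered_matching_def pairwise_def)
      then show "disjnt (g ` d) (g ` e)"
        using inj_on_image_Int[OF inj, of d e] de(1,2) by (simp add: disjnt_def Union_upper)
    qed
  next
    fix e assume "e \<in> (`) g ` M"
    then obtain d where d: "d \<in> M" "e = g ` d" by auto
    then show "finite e" using M by (auto simp: ordered_matching_def)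
    have "inj_on g d" using inj d by (meson Sup_upper inj_on_subset)
    then show "card e = r" using d M by (simp add: card_image ordered_matching_def)
  qed
  then have "min_max_twins r n \<le> max_twins N"
    unfolding min_max_twins_def by (intro Min_le[OF finite_max_twins_values]) blast
  also have "max_twins N \<le> max_twins M"
  proof -
    have "finite N" using finM by (simp add: N_def)
    then obtain A' B' where tw: "twins N A' B'" and c: "card A' = max_twins N"
      using max_twins_attained by blast
    have "A' \<subseteq> (`) g ` M" "B' \<subseteq> (`) g ` M" using tw by (simp_all add: twins_def N_def)
    then obtain A B where A: "A \<subseteq> M" "A' = (`) g ` A" and B: "B \<subseteq> M" "B' = (`) g ` B"
      by (elim subset_imageE)
    have UA: "\<Union>A' = g ` \<Union>A" and UB: "\<Union>B' = g ` \<Union>B" using A B by auto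
    have VA: "\<Union>A \<subseteq> ?V" and VB: "\<Union>B \<subseteq> ?V" using A B by auto
    have bA: "bij_betw g (\<Union>A) (\<Union>A')" and bB: "bij_betw g (\<Union>B) (\<Union>B')"
      using inj_on_subset[OF inj VA] inj_on_subset[OF inj VB] by (simp_all only: bij_betw_def UA UB)
    have bA2: "bij_betw ((`) g) A A'" and bB2: "bij_betw ((`) g) B B'"
      using inj_on_subset[OF injI A(1)] inj_on_subset[OF injI B(1)] A B by (simp_all only: bij_betw_def)
    obtain f where f: "bij_betw f (\<Union>A') (\<Union>B')" "strict_mono_on (\<Union>A') f" "bij_betw ((`) f) A' B'"
      using tw by (auto simp: twins_def isomorphic_matchings_def)
    define h where "h = inv_into (\<Union>B) g"
    have bh: "bij_betw h (\<Union>B') (\<Union>B)" unfolding h_def using bB by (rule bij_betw_inv_into)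
    have gh: "g (h y) = y" if "y \<in> \<Union>B'" for y
      unfolding h_def by (rule bij_betw_inv_into_right[OF bB that])
    have hg: "h (g x) = x" if "x \<in> \<Union>B" for x
      unfolding h_def by (rule bij_betw_inv_into_left[OF bB that])
    define k where "k = h \<circ> f \<circ> g"
    have "bij_betw k (\<Union>A) (\<Union>B)" unfolding k_def
      using bij_betw_trans[OF bA bij_betw_trans[OF f(1) bh]] by simp
    moreover have "strict_mono_on (\<Union>A) k"
    proof (rule strict_mono_onI)
      fix x y assume xy: "x \<in> \<Union>A" "y \<in> \<Union>A" "x < y"
      have gm: "g x \<in> \<Union>A'" "g y \<in> \<Union>A'" using bij_betwE[OF bA] xy(1,2) by blast+
      have "g x < g y" by (rule strict_mono_onD[OF mono]) (use xy VA in blast)+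
      then have lt: "f (g x) < f (g y)"
        using strict_mono_onD[OF f(2) gm] by simp
      have m: "f (g x) \<in> \<Union>B'" "f (g y) \<in> \<Union>B'" using bij_betwE[OF f(1)] gm by blast+
      have hm: "h (f (g x)) \<in> ?V" "h (f (g y)) \<in> ?V"
        using bij_betwE[OF bh] m VB by blast+
      have "h (f (g x)) < h (f (g y))"
      proof (rule ccontr)
        assume "\<not> ?thesis"
        then have "g (h (f (g y))) \<le> g (h (f (g x)))"
          using strict_mono_onD[OF mono hm(2,1)] by (cases "h (f (g y)) = h (f (g x))") (auto simp: not_less order_le_less)
        then show False using lt gh m by simp
      qed
      then show "k x < k y" by (simp add: k_def)
    qed
    moreover have "bij_betw ((`) k) A B"
    proof -
      have "(`) h ` B' = B"
      proof -
        have "h ` g ` b = b" if "b \<in> B" for b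
        proof -
          have "h (g x) = x" if "x \<in> b" for x by (rule hg) (use \<open>b \<in> B\<close> that in blast)
          then show ?thesis by (simp add: image_image)
        qed
        then have "(\<lambda>b. h ` g ` b) ` B = B" by simp
        then show ?thesis unfolding B(2) by (simp only: image_image)
      qed
      moreover have "inj_on ((`) h) B'"
      proof (rule inj_onI)
        fix b c assume "b \<in> B'" "c \<in> B'" "h ` b = h ` c"
        then show "b = c"
          using inj_on_image_eq_iff[OF bij_betw_imp_inj_on[OF bh], of b c] by (simp add: Union_upper)
      qed
      ultimately have "bij_betw ((`) h) B' B" by (simp add: bij_betw_def)
      then have "bij_betw ((`) h \<circ> ((`) f \<circ> (`) g)) A B"
        by (rule bij_betw_trans[OF bij_betw_trans[OF bA2 f(3)]])
      moreover have "(`) h \<circ> ((`) f \<circ> (`) g) = (`) k" by (simp add: fun_eq_iff k_def image_image)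
      ultimately show ?thesis by simp
    qed
    ultimately have "isomorphic_matchings A B" unfolding isomorphic_matchings_def by blast
    moreover have "\<Union>A \<inter> \<Union>B = {}"
    proof -
      have "g ` \<Union>A \<inter> g ` \<Union>B = {}" using tw unfolding twins_def UA UB by blast
      then show ?thesis by blast
    qed
    ultimately have "twins M A B" using A B by (simp add: twins_def)
    then have "card A \<le> max_twins M" by (rule card_le_max_twins[OF finM])
    then show ?thesis using c bij_betw_same_card[OF bA2] by simp
  qed
  finally show ?thesis .
qed

end

theory Submission
  imports Defs
begin

text \<open>
  Twins in permutations have size \<open>\<Omega>(n\<^sup>3\<^sup>/\<^sup>5)\<close> by an argument of Bukh and Rudenko: cut \<open>60 s\<^sup>5\<close> points
  into \<open>2 s\<^sup>2\<close> columns and \<open>4 s\<^sup>3\<close> rows of equal size.  In a column, group the points of a common row into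
  triples; among the three orders in which the first, second and third points of \<open>s\<^sup>3\<close> triples appear,
  two agree on \<open>s\<close> triples, which gives twins of size \<open>s\<close> inside the column.  Each of \<open>s\<^sup>2\<close> columns
  contributes in this way while avoiding the rows used before it.  Passing to a monotone subsequence in
  \<open>k\<close> further orders raises the cost from \<open>s\<^sup>5\<close> to its \<open>2\<^sup>k\<close>-th power.

  In a matching, the \<open>i\<close>-th gap is pierced if one point separates the \<open>i\<close>-th from the next vertex of every
  edge.  Given a set of \<open>u \<ge> 1\<close> pierced gaps, either some point lies in an unpierced gap of a
  large share of the edges, and one more gap gets pierced, or few edges interfere and there
  is a large set of edges none of which has a vertex in an unpierced gap of another.  In such a set the
  vertices of an edge move together in \<open>u + 1\<close> blocks, so it behaves like a \<open>u\<close>-tuple of permutations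
  and costs \<open>s\<^sup>5\<close> to the power \<open>2\<^sup>u\<^sup>-\<^sup>1\<close>.  The total cost is \<open>s\<^sup>5\<close> to the power
  \<open>1 + 2 + \<dots> + 2\<^sup>r\<^sup>-\<^sup>2 = 2\<^sup>r\<^sup>-\<^sup>1 - 1\<close>, for twins of size \<open>s\<^sup>3\<close>.  The first gap is pierced at a
  linear cost: cut the vertex set at a point with a quarter of the edges entirely on its left; unless
  linearly many edges cross the cut, at least half of them lie on the right, and twins on the two sides
  can be concatenated.
\<close>

section \<open>Chains, antichains and agreeing orders\<close>

lemma pigeonhole_fibre:
  assumes "finite K" "finite B" "f ` K \<subseteq> B" "card B * b < card K"
  shows "\<exists>y\<in>B. b < card {x\<in>K. f x = y}"
proof (rule ccontr)
  assume "\<not> ?thesis"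
  then have le: "\<And>y. y \<in> B \<Longrightarrow> card {x\<in>K. f x = y} \<le> b" by force
  have "K = (\<Union>y\<in>B. {x\<in>K. f x = y})" using assms(3) by auto
  then have "card K \<le> (\<Sum>y\<in>B. card {x\<in>K. f x = y})"
    using card_UN_le[OF assms(2), of "\<lambda>y. {x\<in>K. f x = y}"] by simp
  also have "\<dots> \<le> card B * b" using sum_bounded_above[of B "\<lambda>y. card {x\<in>K. f x = y}" b] le by simp
  finally show False using assms(4) by simp
qed

text \<open>Mirsky's argument: the size \<open>L e\<close> of a largest chain with top
  \<open>e\<close> strictly increases along \<open>P\<close>, so the fibres of \<open>L\<close> are
  antichains. If \<open>L\<close> never exceeds \<open>a\<close>, there are at most \<open>a\<close>
  fibres, and one of them has more than \<open>b\<close> elements.\<close>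

lemma chain_or_antichain:
  assumes fin: "finite K"
    and P: "transp P" "irreflp P"
    and card: "a * b < card K"
  shows "(\<exists>Q\<subseteq>K. card Q = Suc a \<and> (\<forall>u\<in>Q. \<forall>v\<in>Q. u \<noteq> v \<longrightarrow> P u v \<or> P v u)) \<or>
         (\<exists>Q\<subseteq>K. card Q = Suc b \<and> (\<forall>u\<in>Q. \<forall>v\<in>Q. \<not> P u v))"
proof -
  have trans: "P u w" if "P u v" "P v w" for u v w using P(1) that by (rule transpE)
  have irrefl: "\<not> P u u" for u using P(2) by (simp add: irreflp_def)
  define chain where "chain e Q \<longleftrightarrow> Q \<subseteq> K \<and> e \<in> Q \<and> (\<forall>u\<in>Q. u \<noteq> e \<longrightarrow> P u e) \<and>
    (\<forall>u\<in>Q. \<forall>v\<in>Q. u \<noteq> v \<longrightarrow> P u v \<or> P v u)" for e Q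
  define L where "L e = Max {card Q | Q. chain e Q}" for e
  have finL: "finite {card Q | Q. chain e Q}" for e
    by (rule finite_subset[of _ "card ` Pow K"]) (use fin in \<open>auto simp: chain_def\<close>)
  have "chain e {e}" if "e \<in> K" for e using that by (auto simp: chain_def)
  then have att: "\<exists>Q. chain e Q \<and> card Q = L e" if "e \<in> K" for e
    using Max_in[OF finL[of e]] that unfolding L_def by force
  have le: "card Q \<le> L e" if "chain e Q" for e Q
    unfolding L_def by (rule Max_ge[OF finL]) (use that in blast)
  have mono: "L u < L v" if uv: "u \<in> K" "v \<in> K" "P u v" for u v
  proof -
    obtain Q where Q: "chain u Q" "card Q = L u" using att uv by blast
    have v: "v \<notin> Q" using Q(1) uv(3) trans irrefl unfolding chain_def by metis
    have pv: "P w v" if "w \<in> Q" for w using that Q(1) uv(3) trans unfolding chain_def by metis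
    have "chain v (insert v Q)" using Q(1) pv uv unfolding chain_def by auto
    moreover have "finite Q" using Q(1) fin finite_subset by (auto simp: chain_def)
    ultimately show ?thesis using le[of v "insert v Q"] v Q(2) by simp
  qed
  show ?thesis
  proof (cases "\<exists>e\<in>K. a < L e")
    case True
    then obtain e Q where "chain e Q" "Suc a \<le> card Q" using att by fastforce
    then obtain Q' where "Q' \<subseteq> Q" "card Q' = Suc a" using obtain_subset_with_card_n by metis
    moreover have "Q' \<subseteq> K" using \<open>chain e Q\<close> \<open>Q' \<subseteq> Q\<close> by (auto simp: chain_def)
    moreover have "P u v \<or> P v u" if "u \<in> Q'" "v \<in> Q'" "u \<noteq> v" for u v
      using \<open>chain e Q\<close> that subsetD[OF \<open>Q' \<subseteq> Q\<close>] unfolding chain_def by simp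
    ultimately show ?thesis by metis
  next
    case False
    have "1 \<le> L e" if "e \<in> K" for e using le[of e "{e}"] that by (auto simp: chain_def)
    then have "L ` K \<subseteq> {1..a}" using False by force
    then obtain l where l: "b < card {e\<in>K. L e = l}"
      using pigeonhole_fibre[OF fin, of "{1..a}" L b] card by auto
    then obtain Q where Q: "Q \<subseteq> {e\<in>K. L e = l}" "card Q = Suc b"
      by (meson Suc_leI obtain_subset_with_card_n)
    have "\<not> P u v" if "u \<in> Q" "v \<in> Q" for u v
      using mono[of u v] subsetD[OF Q(1)] that by fastforce
    with Q show ?thesis by (intro disjI2 exI[of _ Q]) auto
  qed
qed

text \<open>Chains for the order "smaller under both \<open>f\<close> and \<open>g\<close>" are sets
  on which \<open>g\<close> follows \<open>f\<close>; by injectivity, antichains are sets on which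
  \<open>g\<close> reverses \<open>f\<close>.\<close>

lemma erdos_szekeres:
  fixes f :: "'a \<Rightarrow> 'b::linorder" and g :: "'a \<Rightarrow> 'c::linorder"
  assumes fin: "finite K" and inj: "inj_on f K" "inj_on g K" and card: "m ^ 2 \<le> card K"
  shows "\<exists>Q\<subseteq>K. card Q = m \<and>
    ((\<forall>u\<in>Q. \<forall>v\<in>Q. g u < g v \<longleftrightarrow> f u < f v) \<or> (\<forall>u\<in>Q. \<forall>v\<in>Q. g u < g v \<longleftrightarrow> f v < f u))"
proof (cases m)
  case (Suc k)
  have "k * k < card K" using card Suc by (simp add: power2_eq_square)
  moreover have "transp (\<lambda>u v. f u < f v \<and> g u < g v)" "irreflp (\<lambda>u v. f u < f v \<and> g u < g v)"
    by (auto simp: transp_def irreflp_def)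
  ultimately have "(\<exists>Q\<subseteq>K. card Q = Suc k \<and> (\<forall>u\<in>Q. \<forall>v\<in>Q. u \<noteq> v \<longrightarrow>
          f u < f v \<and> g u < g v \<or> f v < f u \<and> g v < g u)) \<or>
        (\<exists>Q\<subseteq>K. card Q = Suc k \<and> (\<forall>u\<in>Q. \<forall>v\<in>Q. \<not> (f u < f v \<and> g u < g v)))"
    by (intro chain_or_antichain[OF fin])
  then show ?thesis
  proof (elim disjE exE conjE, goal_cases)
    case (1 Q)
    have "g u < g v \<longleftrightarrow> f u < f v" if "u \<in> Q" "v \<in> Q" for u v
    proof (cases "u = v")
      case False
      then have "f u < f v \<and> g u < g v \<or> f v < f u \<and> g v < g u" using 1 that by blast
      then show ?thesis by auto
    qed simp
    then show ?case using 1 Suc by blast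
  next
    case (2 Q)
    have "g u < g v \<longleftrightarrow> f v < f u" if "u \<in> Q" "v \<in> Q" for u v
    proof (cases "u = v")
      case False
      have "\<not> (f u < f v \<and> g u < g v)" "\<not> (f v < f u \<and> g v < g u)" using 2 that by blast+
      moreover have "f u \<noteq> f v" "g u \<noteq> g v" using False that 2(1) inj by (meson inj_on_def subsetD)+
      ultimately show ?thesis by auto
    qed simp
    then show ?case using 2 Suc by blast
  qed
qed (auto intro: exI[of _ "{}"])

text \<open>Two rounds of the chain dichotomy. Without a chain, orders 0 and 1 are opposite on a
  large set; inside it the same holds for orders 0 and 2, and then orders 1 and 2 both reverse order
  0 and hence agree.\<close>

lemma two_of_three_orders_agree:
  fixes f :: "nat \<Rightarrow> 'a \<Rightarrow> 'b::linorder"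
  assumes fin: "finite K" and inj: "\<And>l. l < 3 \<Longrightarrow> inj_on (f l) K" and card: "s ^ 3 \<le> card K"
  shows "\<exists>l l' Q. l < 3 \<and> l' < 3 \<and> l \<noteq> l' \<and> Q \<subseteq> K \<and> card Q = s \<and>
    (\<forall>u\<in>Q. \<forall>v\<in>Q. f l u < f l v \<longleftrightarrow> f l' u < f l' v)"
proof (cases s)
  case 0
  then show ?thesis by (intro exI[of _ 0] exI[of _ 1] exI[of _ "{}"]) simp
next
  case (Suc k)
  define P where "P l l' u v \<longleftrightarrow> f l u < f l v \<and> f l' u < f l' v" for l l' u v
  have agree: ?thesis if "l < 3" "l' < 3" "l \<noteq> l'" "Q \<subseteq> K" "card Q = Suc k"
    "\<forall>u\<in>Q. \<forall>v\<in>Q. u \<noteq> v \<longrightarrow> P l l' u v \<or> P l l' v u" for l l' Q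
  proof -
    have "f l u < f l v \<longleftrightarrow> f l' u < f l' v" if "u \<in> Q" "v \<in> Q" for u v
    proof (cases "u = v")
      case False
      then have "P l l' u v \<or> P l l' v u" using \<open>\<forall>u\<in>Q. _ u\<close> that by blast
      then show ?thesis by (auto simp: P_def)
    qed simp
    then show ?thesis using that Suc by blast
  qed
  have trans: "transp (P l l')" and irrefl: "irreflp (P l l')" for l l'
    by (auto simp: P_def transp_def irreflp_def)
  have "k ^ 3 < s ^ 3" using Suc by (intro power_strict_mono) auto
  \<comment> \<open>With \<open>s = k + 1\<close>, the first round yields a chain of
    \<open>k + 1\<close> points or an antichain of \<open>k * k + 1\<close>, just enough for the
    second round to produce \<open>k + 1\<close> points.\<close>
  then have "k * (k * k) < card K" using card by (simp add: power3_eq_cube mult.assoc)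
  from chain_or_antichain[of K "P 0 1", OF fin trans irrefl this]
  show ?thesis
  proof (elim disjE exE conjE)
    fix Q assume Q: "Q \<subseteq> K" "card Q = Suc (k * k)" "\<forall>u\<in>Q. \<forall>v\<in>Q. \<not> P 0 1 u v"
    have "finite Q" using Q(1) fin finite_subset by blast
    from chain_or_antichain[of Q "P 0 2", OF this trans irrefl, of k k] Q(2)
    have "(\<exists>Q'\<subseteq>Q. card Q' = Suc k \<and> (\<forall>u\<in>Q'. \<forall>v\<in>Q'. u \<noteq> v \<longrightarrow> P 0 2 u v \<or> P 0 2 v u)) \<or>
         (\<exists>Q'\<subseteq>Q. card Q' = Suc k \<and> (\<forall>u\<in>Q'. \<forall>v\<in>Q'. \<not> P 0 2 u v))" by simp
    then show ?thesis
    proof (elim disjE exE conjE)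
      fix Q' assume Q': "Q' \<subseteq> Q" "card Q' = Suc k" "\<forall>u\<in>Q'. \<forall>v\<in>Q'. \<not> P 0 2 u v"
      have "P 1 2 u v \<or> P 1 2 v u" if "u \<in> Q'" "v \<in> Q'" "u \<noteq> v" for u v
      proof -
        have "u \<in> K" "v \<in> K" "u \<in> Q" "v \<in> Q" using that Q' Q by auto
        then have "f l u \<noteq> f l v" if "l < 3" for l
          using inj[OF that] \<open>u \<noteq> v\<close> by (meson inj_on_def)
        from this[of 0] this[of 1] this[of 2]
        have "f 0 u \<noteq> f 0 v" "f 1 u \<noteq> f 1 v" "f 2 u \<noteq> f 2 v" by simp_all
        moreover have "\<not> P 0 1 u v" "\<not> P 0 1 v u" "\<not> P 0 2 u v" "\<not> P 0 2 v u"
          using Q Q' \<open>u \<in> Q\<close> \<open>v \<in> Q\<close> that by blast+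
        ultimately show ?thesis unfolding P_def by (metis linorder_neqE)
      qed
      then show ?thesis using agree[of 1 2 Q'] Q Q' by simp
    next
      fix Q' assume "Q' \<subseteq> Q" "card Q' = Suc k" "\<forall>u\<in>Q'. \<forall>v\<in>Q'. u \<noteq> v \<longrightarrow> P 0 2 u v \<or> P 0 2 v u"
      then show ?thesis using agree[of 0 2 Q'] Q(1) by simp
    qed
  qed (use agree[of 0 1] in auto)
qed

lemma rank_function:
  fixes y :: "'a \<Rightarrow> 'b::linorder"
  assumes fin: "finite D" and inj: "inj_on y D"
  shows "\<exists>\<rho>. bij_betw \<rho> D {..<card D} \<and> (\<forall>e\<in>D. \<forall>f\<in>D. \<rho> e < \<rho> f \<longleftrightarrow> y e < y f)"
proof -
  define \<rho> where "\<rho> e = card {g\<in>D. y g < y e}" for e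
  have mono: "\<rho> e < \<rho> f" if "e \<in> D" "y e < y f" for e f
    unfolding \<rho>_def by (rule psubset_card_mono) (use that fin in auto)
  have iff: "\<rho> e < \<rho> f \<longleftrightarrow> y e < y f" if ef: "e \<in> D" "f \<in> D" for e f
  proof (cases "y e = y f")
    case False
    then show ?thesis using mono[of e f] mono[of f e] ef by (metis linorder_neqE order_less_asym)
  qed (simp add: \<rho>_def)
  have "inj_on \<rho> D"
  proof (rule inj_onI)
    fix e f assume *: "e \<in> D" "f \<in> D" "\<rho> e = \<rho> f"
    then have "y e = y f" using iff[of e f] iff[of f e] by (metis linorder_neqE less_irrefl)
    then show "e = f" using inj * by (simp add: inj_on_def)
  qed
  moreover have "\<rho> ` D \<subseteq> {..<card D}"
  proof clarify
    fix e assume "e \<in> D"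
    then show "\<rho> e < card D" unfolding \<rho>_def by (intro psubset_card_mono) (use fin in auto)
  qed
  ultimately have "bij_betw \<rho> D {..<card D}"
    by (simp add: bij_betw_def card_image card_subset_eq)
  with iff show ?thesis by blast
qed

section \<open>Twins in permutations\<close>

text \<open>Candidate twins: \<open>T\<close> and its image are the two disjoint halves inside
  \<open>E\<close>, matched by \<open>\<phi>\<close>. Which orders \<open>\<phi>\<close> respects is
  stated separately each time.\<close>

definition shift_map :: "'a set \<Rightarrow> 'a set \<Rightarrow> ('a \<Rightarrow> 'a) \<Rightarrow> bool" where
  "shift_map E T \<phi> \<longleftrightarrow> T \<subseteq> E \<and> \<phi> ` T \<subseteq> E \<and> inj_on \<phi> T \<and> \<phi> ` T \<inter> T = {}"

lemma shift_map_mono: "shift_map D T \<phi> \<Longrightarrow> D \<subseteq> E \<Longrightarrow> shift_map E T \<phi>"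
  by (auto simp: shift_map_def)

lemma shift_map_union:
  assumes "shift_map E T \<phi>" "shift_map E' T' \<phi>'" "(T \<union> \<phi> ` T) \<inter> (T' \<union> \<phi>' ` T') = {}"
  shows "shift_map (E \<union> E') (T \<union> T') (\<lambda>e. if e \<in> T then \<phi> e else \<phi>' e)"
proof -
  let ?\<psi> = "\<lambda>e. if e \<in> T then \<phi> e else \<phi>' e"
  have disj: "T \<inter> T' = {}" using assms(3) by blast
  then have *: "?\<psi> ` T = \<phi> ` T" "?\<psi> ` T' = \<phi>' ` T'" by (auto intro!: image_cong)
  have "inj_on ?\<psi> T" "inj_on ?\<psi> T'"
    using assms(1,2) disj unfolding shift_map_def by (auto simp: inj_on_def)
  moreover have "?\<psi> ` (T - T') \<inter> ?\<psi> ` (T' - T) = {}"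
    using assms(3) * by blast
  ultimately have "inj_on ?\<psi> (T \<union> T')" by (simp add: inj_on_Un)
  moreover have "?\<psi> ` (T \<union> T') = \<phi> ` T \<union> \<phi>' ` T'" using * by (simp only: image_Un)
  ultimately show ?thesis
    using assms unfolding shift_map_def by (simp only:) blast
qed

text \<open>
  Cutting the points of one column, listed by value, into consecutive triples: at most \<open>R\<close> triples
  meet two rows, and two of the three position orders on the remaining triples agree on many of them.
\<close>

lemma column_twins:
  fixes pos :: "'a \<Rightarrow> 'b::linorder" and val :: "'a \<Rightarrow> 'c::linorder" and row :: "'a \<Rightarrow> nat"
  assumes fin: "finite P" and inj: "inj_on pos P" "inj_on val P"
    and row_mono: "\<And>e f. e \<in> P \<Longrightarrow> f \<in> P \<Longrightarrow> val e < val f \<Longrightarrow> row e \<le> row f"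
    and row: "row ` P \<subseteq> {..<R}" and card: "3 * (R + s ^ 3) \<le> card P"
  shows "\<exists>T \<phi>. shift_map P T \<phi> \<and> card T = s \<and> (\<forall>e\<in>T. row (\<phi> e) = row e) \<and>
    (\<forall>e\<in>T. \<forall>f\<in>T. (pos e < pos f \<longleftrightarrow> pos (\<phi> e) < pos (\<phi> f)) \<and>
       (val e < val f \<longleftrightarrow> val (\<phi> e) < val (\<phi> f)))"
proof -
  obtain \<rho> where \<rho>: "bij_betw \<rho> P {..<card P}"
    and \<rho>_iff: "\<And>e f. e \<in> P \<Longrightarrow> f \<in> P \<Longrightarrow> \<rho> e < \<rho> f \<longleftrightarrow> val e < val f"
    using rank_function[OF fin inj(2)] by blast
  define h where "h = inv_into P \<rho>"
  have h: "h i \<in> P" "\<rho> (h i) = i" if "i < card P" for i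
    using that bij_betw_inv_into_right[OF \<rho>] bij_betwE[OF bij_betw_inv_into[OF \<rho>]]
    by (auto simp: h_def)
  have h_less: "val (h i) < val (h j) \<longleftrightarrow> i < j" if "i < card P" "j < card P" for i j
    using \<rho>_iff[of "h i" "h j"] h that by simp
  have row_h: "row (h i) \<le> row (h j)" if "i \<le> j" "j < card P" for i j
    using that row_mono[of "h i" "h j"] h h_less[of i j] by (cases "i = j") auto
  \<comment> \<open>Up to \<open>R\<close> triples are lost because they meet two rows; the
    remaining \<open>s ^ 3\<close> are what the agreement of two of three orders needs.\<close>
  define q where "q = R + s ^ 3"
  have "3 * q \<le> card P" using card by (simp add: q_def)
  then have lt: "3 * t + l < card P" if "t < q" "l < 3" for t l using that by linarith
  define a where "a l t = h (3 * t + l)" for l t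
  have a_in: "a l t \<in> P" if "t < q" "l < 3" for t l using h(1) lt that by (simp add: a_def)
  have a_val: "val (a l t) < val (a l' t') \<longleftrightarrow> 3 * t + l < 3 * t' + l'"
    if "t < q" "l < 3" "t' < q" "l' < 3" for t l t' l'
    using h_less lt that by (simp add: a_def)
  have a_eq: "a l t = a l' t' \<longleftrightarrow> t = t' \<and> l = l'"
    if "t < q" "l < 3" "t' < q" "l' < 3" for t l t' l'
  proof -
    have "a l t = a l' t' \<longleftrightarrow> 3 * t + l = 3 * t' + l'"
      using h(2)[OF lt, of t l] h(2)[OF lt, of t' l'] that unfolding a_def by metis
    also have "\<dots> \<longleftrightarrow> t = t' \<and> l = l'"
      using that(2,4) by (cases t t' rule: linorder_cases) auto
    finally show ?thesis .
  qed
  have a_row: "row (a l t) \<le> row (a l' t')"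
    if "3 * t + l \<le> 3 * t' + l'" "t' < q" "l' < 3" for t l t' l'
    using row_h lt that by (simp add: a_def)
  define bad where "bad = {t. t < q \<and> row (a 0 t) \<noteq> row (a 2 t)}"
  define good where "good = {t. t < q \<and> row (a 0 t) = row (a 2 t)}"
  \<comment> \<open>A triple that meets two rows moves to a higher row between its first and last
    point, so the first points of bad triples lie in different rows.\<close>
  have bad_less: "row (a 0 t) < row (a 0 t')" if "t \<in> bad" "t' \<in> bad" "t < t'" for t t'
    using that a_row[of t 0 t 2] a_row[of t 2 t' 0] by (simp add: bad_def)
  have "inj_on (\<lambda>t. row (a 0 t)) bad"
  proof (rule inj_onI)
    fix t t' assume "t \<in> bad" "t' \<in> bad" "row (a 0 t) = row (a 0 t')"
    then show "t = t'" using bad_less[of t t'] bad_less[of t' t] by (cases t t' rule: linorder_cases) auto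
  qed
  moreover have "(\<lambda>t. row (a 0 t)) ` bad \<subseteq> {..<R}"
    using row a_in[of _ 0] by (force simp: bad_def)
  ultimately have "card bad \<le> R" using card_inj_on_le[of _ bad "{..<R}"] by simp
  moreover have "card bad + card good = q"
  proof -
    have "finite bad" "finite good" "bad \<inter> good = {}" "bad \<union> good = {..<q}"
      by (auto simp: bad_def good_def)
    then show ?thesis using card_Un_disjoint[of bad good] by simp
  qed
  ultimately have good: "s ^ 3 \<le> card good" by (simp add: q_def)
  have "finite good" by (simp add: good_def)
  moreover have "inj_on (\<lambda>t. pos (a l t)) good" if "l < 3" for l
  proof (rule inj_onI)
    fix t t' assume "t \<in> good" "t' \<in> good" "pos (a l t) = pos (a l t')"
    then show "t = t'" using a_in a_eq that inj(1) unfolding good_def inj_on_def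
      by (metis (no_types, lifting) mem_Collect_eq)
  qed
  ultimately obtain l l' Q where Q: "l < 3" "l' < 3" "l \<noteq> l'" "Q \<subseteq> good" "card Q = s"
    and agree: "\<And>u v. u \<in> Q \<Longrightarrow> v \<in> Q \<Longrightarrow> pos (a l u) < pos (a l v) \<longleftrightarrow> pos (a l' u) < pos (a l' v)"
    using two_of_three_orders_agree[of good "\<lambda>l t. pos (a l t)" s] good by blast
  have Qq: "t < q" if "t \<in> Q" for t using that Q(4) by (auto simp: good_def)
  have inja: "inj_on (a l) Q" "inj_on (a l') Q" using a_eq Qq Q(1,2) by (auto simp: inj_on_def)
  \<comment> \<open>The twins are the \<open>l\<close>-th and the \<open>l'\<close>-th points of the
    chosen triples. Positions agree by the choice of \<open>Q\<close>, values because each triple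
    consists of consecutive ranks.\<close>
  define \<phi> where "\<phi> = a l' \<circ> inv_into Q (a l)"
  have \<phi>: "\<phi> (a l t) = a l' t" if "t \<in> Q" for t using that inja by (simp add: \<phi>_def)
  have im: "\<phi> ` a l ` Q = a l' ` Q" using \<phi> by (auto simp: image_image)
  have "shift_map P (a l ` Q) \<phi>" unfolding shift_map_def im
  proof (intro conjI)
    show "inj_on \<phi> (a l ` Q)" using \<phi> inja(2) by (auto simp: inj_on_def)
    show "a l ` Q \<subseteq> P" "a l' ` Q \<subseteq> P" using a_in Qq Q by auto
    show "a l' ` Q \<inter> a l ` Q = {}" using a_eq Qq Q by fastforce
  qed
  moreover have "card (a l ` Q) = s" using inja Q by (simp add: card_image)
  moreover have "row (\<phi> (a l t)) = row (a l t)" if "t \<in> Q" for t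
  proof -
    have "row (a 0 t) = row (a 2 t)" using that Q(4) by (auto simp: good_def)
    moreover have "row (a 0 t) \<le> row (a k t) \<and> row (a k t) \<le> row (a 2 t)" if "k < 3" for k
      using a_row[of t 0 t k] a_row[of t k t 2] Qq[OF \<open>t \<in> Q\<close>] that by simp
    ultimately show ?thesis using \<phi>[OF that] Q(1,2) by (metis le_antisym)
  qed
  moreover have "val (a l t) < val (a l t') \<longleftrightarrow> val (a l' t) < val (a l' t')" if "t \<in> Q" "t' \<in> Q" for t t'
    using a_val Qq Q(1,2) that by auto
  ultimately show ?thesis using agree \<phi>
    by (intro exI[of _ "a l ` Q"] exI[of _ \<phi>]) auto
qed

lemma card_rank_block:
  fixes \<rho> :: "'a \<Rightarrow> nat"
  assumes "bij_betw \<rho> D {..<m * N}" "c < m" "N > 0"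
  shows "card {e\<in>D. \<rho> e div N = c} = N"
proof -
  have "\<rho> ` {e\<in>D. \<rho> e div N = c} = {c * N..<Suc c * N}"
  proof (intro subset_antisym subsetI)
    fix x assume x: "x \<in> {c * N..<Suc c * N}"
    have "Suc c * N \<le> m * N" using assms(2) by (intro mult_right_mono) auto
    with x have "x \<in> \<rho> ` D" using assms(1) by (auto simp: bij_betw_def)
    moreover have "x div N = c" using x assms(3)
      by (intro div_nat_eqI) (auto simp: mult.commute)
    ultimately show "x \<in> \<rho> ` {e\<in>D. \<rho> e div N = c}" by auto
  next
    fix x assume "x \<in> \<rho> ` {e\<in>D. \<rho> e div N = c}"
    then have "x div N = c" by auto
    then show "x \<in> {c * N..<Suc c * N}" using assms(3)
      by (auto simp: div_times_less_eq_dividend dividend_less_div_times)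
  qed
  moreover have "inj_on \<rho> {e\<in>D. \<rho> e div N = c}"
    using assms(1) by (auto simp: bij_betw_def intro: inj_on_subset)
  ultimately show ?thesis using card_image by fastforce
qed

text \<open>Twins are gathered greedily, \<open>s\<close> pairs from each of \<open>s ^ 2\<close>
  columns, every new column using only rows untouched so far. The map keeps rows and columns, so
  comparisons between contributions of different columns are preserved automatically.\<close>

lemma permutation_twins:
  fixes pos :: "'a \<Rightarrow> 'b::linorder" and val :: "'a \<Rightarrow> 'c::linorder"
  assumes fin: "finite D" and inj: "inj_on pos D" "inj_on val D" and card: "60 * s ^ 5 \<le> card D"
  shows "\<exists>T \<phi>. shift_map D T \<phi> \<and> card T = s ^ 3 \<and>
    (\<forall>e\<in>T. \<forall>f\<in>T. (pos e < pos f \<longleftrightarrow> pos (\<phi> e) < pos (\<phi> f)) \<and>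
       (val e < val f \<longleftrightarrow> val (\<phi> e) < val (\<phi> f)))"
proof (cases "s = 0")
  case True
  then show ?thesis by (intro exI[of _ "{}"]) (auto simp: shift_map_def)
next
  case False
  then have s: "s > 0" by simp
  obtain D' where D': "D' \<subseteq> D" "card D' = 60 * s ^ 5"
    using card obtain_subset_with_card_n by metis
  have finD': "finite D'" and inj': "inj_on pos D'" "inj_on val D'"
    using D'(1) fin inj finite_subset inj_on_subset by blast+
  obtain p where p: "bij_betw p D' {..<card D'}"
    and p_iff: "\<And>e f. e \<in> D' \<Longrightarrow> f \<in> D' \<Longrightarrow> p e < p f \<longleftrightarrow> pos e < pos f"
    using rank_function[OF finD' inj'(1)] by blast
  obtain v where v: "bij_betw v D' {..<card D'}"
    and v_iff: "\<And>e f. e \<in> D' \<Longrightarrow> f \<in> D' \<Longrightarrow> v e < v f \<longleftrightarrow> val e < val f"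
    using rank_function[OF finD' inj'(2)] by blast
  \<comment> \<open>\<open>R * W\<close> and \<open>C * N\<close> both equal
    \<open>60 * s ^ 5\<close>. There are twice as many columns as get used, and each holds twice the
    \<open>15 * s ^ 3 = 3 * (R + s ^ 3)\<close> points that a column has to supply.\<close>
  define W where "W = 15 * s ^ 2"
  define N where "N = 30 * s ^ 3"
  define R where "R = 4 * s ^ 3"
  define C where "C = 2 * s ^ 2"
  have WN: "W > 0" "N > 0" using s by (auto simp: W_def N_def)
  have cardD: "card D' = R * W" "card D' = C * N"
    by (simp_all add: D'(2) R_def W_def C_def N_def flip: power_add)
  define col where "col e = p e div N" for e
  define row where "row e = v e div W" for e
  have col_lt: "col e < C" if "e \<in> D'" for e
    using bij_betwE[OF p] that cardD(2) by (auto simp: col_def less_mult_imp_div_less)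
  have row_lt: "row e < R" if "e \<in> D'" for e
    using bij_betwE[OF v] that cardD(1) by (auto simp: row_def less_mult_imp_div_less)
  have card_col: "card {e\<in>D'. col e = c} = N" if "c < C" for c
    unfolding col_def using card_rank_block[of p D' C N c] p cardD(2) that WN by simp
  have card_row: "card {e\<in>D'. row e = c} = W" if "c < R" for c
    unfolding row_def using card_rank_block[of v D' R W c] v cardD(1) that WN by simp
  have col_mono: "col e \<le> col f" if "e \<in> D'" "f \<in> D'" "pos e < pos f" for e f
    unfolding col_def using p_iff[OF that(1,2)] that(3) by (intro div_le_mono) simp
  have row_mono: "row e \<le> row f" if "e \<in> D'" "f \<in> D'" "val e < val f" for e f
    unfolding row_def using v_iff[OF that(1,2)] that(3) by (intro div_le_mono) simp
  have pos_col: "pos e < pos f \<longleftrightarrow> col e < col f" if "e \<in> D'" "f \<in> D'" "col e \<noteq> col f" for e f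
    using col_mono[of e f] col_mono[of f e] that inj'(1)
    by (metis antisym_conv2 inj_on_contraD linorder_less_linear order.asym)
  have val_row: "val e < val f \<longleftrightarrow> row e < row f" if "e \<in> D'" "f \<in> D'" "row e \<noteq> row f" for e f
    using row_mono[of e f] row_mono[of f e] that inj'(2)
    by (metis antisym_conv2 inj_on_contraD linorder_less_linear order.asym)
  define good where "good T \<phi> \<longleftrightarrow> shift_map D' T \<phi> \<and> (\<forall>e\<in>T. col (\<phi> e) = col e \<and> row (\<phi> e) = row e) \<and>
    (\<forall>e\<in>T. \<forall>f\<in>T. (pos e < pos f \<longleftrightarrow> pos (\<phi> e) < pos (\<phi> f)) \<and>
       (val e < val f \<longleftrightarrow> val (\<phi> e) < val (\<phi> f)))" for T \<phi>
  have "\<exists>T \<phi>. good T \<phi> \<and> card T = j * s \<and> card (col ` T) \<le> j" if "j \<le> s ^ 2" for j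
    using that
  proof (induction j)
    case 0
    show ?case by (intro exI[of _ "{}"]) (auto simp: good_def shift_map_def)
  next
    case (Suc j)
    then obtain T \<phi> where T: "good T \<phi>" "card T = j * s" "card (col ` T) \<le> j" by auto
    have TD: "T \<subseteq> D'" "\<phi> ` T \<subseteq> D'" using T(1) by (auto simp: good_def shift_map_def)
    have finT: "finite T" using TD finD' finite_subset by blast
    \<comment> \<open>The points blocked by earlier choices: they fill at most
      \<open>j * s \<le> s ^ 3\<close> rows of \<open>W\<close> points each.\<close>
    define U where "U = {e\<in>D'. row e \<in> row ` T}"
    have U: "card U \<le> 15 * s ^ 5"
    proof -
      have "U = (\<Union>y\<in>row ` T. {e\<in>D'. row e = y})" by (auto simp: U_def)
      then have "card U \<le> (\<Sum>y\<in>row ` T. card {e\<in>D'. row e = y})"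
        using card_UN_le[of "row ` T" "\<lambda>y. {e\<in>D'. row e = y}"] finT by simp
      also have "\<dots> = (\<Sum>y\<in>row ` T. W)"
        using card_row row_lt subsetD[OF TD(1)] by (intro sum.cong) auto
      also have "\<dots> = card (row ` T) * W" by simp
      also have "\<dots> \<le> card T * W" using finT by (intro mult_right_mono card_image_le) auto
      also have "\<dots> = j * s * W" by (simp add: T(2))
      also have "\<dots> \<le> s ^ 2 * s * W" using Suc.prems by (intro mult_right_mono) auto
      also have "\<dots> = 15 * s ^ 5" by (simp add: W_def power_numeral_even power_numeral_odd mult_ac)
      finally show ?thesis .
    qed
    define A where "A = {..<C} - col ` T"
    have "\<exists>c\<in>A. 15 * s ^ 3 \<le> card {e\<in>D'. col e = c \<and> row e \<notin> row ` T}"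
    proof (rule ccontr)
      assume "\<not> ?thesis"
      then have few: "card {e\<in>D'. col e = c \<and> row e \<notin> row ` T} < 15 * s ^ 3" if "c \<in> A" for c
        using that by (meson not_le)
      have many: "15 * s ^ 3 + 1 \<le> card {e\<in>U. col e = c}" if "c \<in> A" for c
      proof -
        have "{e\<in>D'. col e = c} = {e\<in>D'. col e = c \<and> row e \<notin> row ` T} \<union> {e\<in>U. col e = c}"
          by (auto simp: U_def)
        then have "N \<le> card {e\<in>D'. col e = c \<and> row e \<notin> row ` T} + card {e\<in>U. col e = c}"
          using card_Un_le card_col[of c] that by (metis (no_types, lifting) A_def Diff_iff lessThan_iff)
        then show ?thesis using few[OF that] by (simp add: N_def)
      qed
      have "s ^ 2 \<le> card A"
      proof -
        have "card {..<C} - card (col ` T) \<le> card A"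
          unfolding A_def using finT by (intro diff_card_le_card_Diff) auto
        then show ?thesis using T(3) Suc.prems by (simp add: C_def)
      qed
      then have "s ^ 2 * (15 * s ^ 3 + 1) \<le> card A * (15 * s ^ 3 + 1)" by (intro mult_right_mono) auto
      also have "\<dots> \<le> (\<Sum>c\<in>A. card {e\<in>U. col e = c})"
        using sum_bounded_below[of A "15 * s ^ 3 + 1" "\<lambda>c. card {e\<in>U. col e = c}"] many by simp
      also have "\<dots> = card (\<Union>c\<in>A. {e\<in>U. col e = c})"
        by (rule card_UN_disjoint[symmetric]) (use finD' in \<open>auto simp: A_def U_def\<close>)
      also have "\<dots> \<le> card U" by (rule card_mono) (use finD' in \<open>auto simp: U_def\<close>)
      also have "\<dots> \<le> 15 * s ^ 5" by (rule U)
      finally have "s ^ 2 * (15 * s ^ 3 + 1) \<le> 15 * s ^ 5" .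
      moreover have "s ^ 2 * (15 * s ^ 3 + 1) = 15 * s ^ 5 + s ^ 2" by (simp add: power_numeral_even power_numeral_odd algebra_simps)
      ultimately have "s ^ 2 \<le> 0" by linarith
      then show False using s by simp
    qed
    then obtain c where c: "c < C" "c \<notin> col ` T"
      and big: "15 * s ^ 3 \<le> card {e\<in>D'. col e = c \<and> row e \<notin> row ` T}" by (auto simp: A_def)
    define P where "P = {e\<in>D'. col e = c \<and> row e \<notin> row ` T}"
    have P: "P \<subseteq> D'" "finite P" using finD' by (auto simp: P_def)
    have "3 * (R + s ^ 3) \<le> card P" using big by (simp add: P_def R_def)
    moreover have "inj_on pos P" "inj_on val P" using P inj' inj_on_subset by blast+
    moreover have "row ` P \<subseteq> {..<R}" using row_lt P by auto
    moreover have "row e \<le> row f" if "e \<in> P" "f \<in> P" "val e < val f" for e f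
      using row_mono that P(1) by blast
    ultimately have "\<exists>T \<phi>. shift_map P T \<phi> \<and> card T = s \<and> (\<forall>e\<in>T. row (\<phi> e) = row e) \<and>
        (\<forall>e\<in>T. \<forall>f\<in>T. (pos e < pos f \<longleftrightarrow> pos (\<phi> e) < pos (\<phi> f)) \<and>
          (val e < val f \<longleftrightarrow> val (\<phi> e) < val (\<phi> f)))"
      by (intro column_twins[OF P(2)])
    then obtain T' \<phi>' where T': "shift_map P T' \<phi>'" "card T' = s" "\<And>e. e \<in> T' \<Longrightarrow> row (\<phi>' e) = row e"
      "\<And>e f. e \<in> T' \<Longrightarrow> f \<in> T' \<Longrightarrow> (pos e < pos f \<longleftrightarrow> pos (\<phi>' e) < pos (\<phi>' f)) \<and>
       (val e < val f \<longleftrightarrow> val (\<phi>' e) < val (\<phi>' f))"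
      by blast
    have T'P: "T' \<subseteq> P" "\<phi>' ` T' \<subseteq> P" using T'(1) by (auto simp: shift_map_def)
    define \<psi> where "\<psi> e = (if e \<in> T then \<phi> e else \<phi>' e)" for e
    have colT: "col (\<phi> e) = col e" "row (\<phi> e) = row e" if "e \<in> T" for e
      using T(1) that by (auto simp: good_def)
    have sep: "(T \<union> \<phi> ` T) \<inter> (T' \<union> \<phi>' ` T') = {}"
    proof -
      have "e \<notin> P" if "e \<in> T \<union> \<phi> ` T" for e using that c(2) colT by (force simp: P_def)
      then show ?thesis using T'P by blast
    qed
    have "shift_map (D' \<union> P) (T \<union> T') \<psi>"
      unfolding \<psi>_def by (rule shift_map_union) (use T(1) T'(1) sep in \<open>auto simp: good_def\<close>)
    then have sm: "shift_map D' (T \<union> T') \<psi>" using P(1) by (simp add: Un_absorb2)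
    have psi: "\<psi> e = \<phi> e" if "e \<in> T" for e using that by (simp add: \<psi>_def)
    have psi': "\<psi> e = \<phi>' e" if "e \<in> T'" for e using that sep by (auto simp: \<psi>_def)
    have c': "col e = c" "row e \<notin> row ` T" if "e \<in> P" for e using that by (auto simp: P_def)
    have pres: "col (\<psi> e) = col e \<and> row (\<psi> e) = row e" if "e \<in> T \<union> T'" for e
      using that
    proof
      assume "e \<in> T'"
      then show ?thesis using psi' T'(3) c'(1) T'P by (metis image_subset_iff subsetD)
    qed (simp add: psi colT)
    have order: "(pos e < pos f \<longleftrightarrow> pos (\<psi> e) < pos (\<psi> f)) \<and> (val e < val f \<longleftrightarrow> val (\<psi> e) < val (\<psi> f))"
      if "e \<in> T \<union> T'" "f \<in> T \<union> T'" for e f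
    proof -
      \<comment> \<open>The third case is an old point against a new one. They differ in column and
        in row, so both comparisons are decided by data that \<open>\<psi>\<close>
        preserves.\<close>
      consider "e \<in> T" "f \<in> T" | "e \<in> T'" "f \<in> T'" | "col e \<noteq> col f" "row e \<noteq> row f"
        using \<open>e \<in> T \<union> T'\<close> \<open>f \<in> T \<union> T'\<close> c(2) c' T'P(1) by (metis UnE image_eqI subsetD)
      then show ?thesis
      proof cases
        case 1
        then show ?thesis using T(1) by (simp add: psi good_def)
      next
        case 2
        then show ?thesis using T'(4) by (simp add: psi')
      next
        case 3
        have "e \<in> D'" "f \<in> D'" "\<psi> e \<in> D'" "\<psi> f \<in> D'" using sm that by (auto simp: shift_map_def)
        then show ?thesis using 3 pres[OF that(1)] pres[OF that(2)]
          pos_col[of e f] pos_col[of "\<psi> e" "\<psi> f"] val_row[of e f] val_row[of "\<psi> e" "\<psi> f"] by simp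
      qed
    qed
    have "good (T \<union> T') \<psi>" using sm pres order by (simp add: good_def)
    moreover have "card (T \<union> T') = Suc j * s"
    proof -
      have "T \<inter> T' = {}" "finite T'" using sep T'P P finite_subset by blast+
      then show ?thesis using finT T(2) T'(2) by (simp add: card_Un_disjoint)
    qed
    moreover have "card (col ` (T \<union> T')) \<le> Suc j"
    proof -
      have "col ` (T \<union> T') \<subseteq> insert c (col ` T)" using c'(1) T'P(1) by auto
      then have "card (col ` (T \<union> T')) \<le> card (insert c (col ` T))" using finT by (intro card_mono) auto
      also have "\<dots> \<le> Suc j" using T(3) finT by (simp add: card_insert_if)
      finally show ?thesis .
    qed
    ultimately show ?case by blast
  qed
  from this[of "s ^ 2"] obtain T \<phi> where "good T \<phi>" "card T = s ^ 3"
    by (auto simp: eval_nat_numeral)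
  then show ?thesis using shift_map_mono[OF _ D'(1)] unfolding good_def by blast
qed

section \<open>Tuples of permutations and sparse conflicts\<close>

text \<open>Each order beyond two costs a square: on a subset of square-root size \<open>y a\<close>
  follows or reverses \<open>y b\<close>, and a map that preserves \<open>y b\<close> there
  preserves \<open>y a\<close> as well. Two orders are the permutation case.\<close>

lemma tuple_twins:
  fixes y :: "'i \<Rightarrow> 'a \<Rightarrow> 'b::linorder"
  assumes "finite D" "finite I" "card I = Suc (Suc k)" "\<And>q. q \<in> I \<Longrightarrow> inj_on (y q) D"
    and "(60 * s ^ 5) ^ (2 ^ k) \<le> card D"
  shows "\<exists>T \<phi>. shift_map D T \<phi> \<and> card T = s ^ 3 \<and>
    (\<forall>q\<in>I. \<forall>e\<in>T. \<forall>f\<in>T. y q e < y q f \<longleftrightarrow> y q (\<phi> e) < y q (\<phi> f))"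
  using assms
proof (induction k arbitrary: D I)
  case 0
  have "card I = 2" using "0.prems"(3) by simp
  then obtain a b where I: "I = {a, b}" by (meson card_2_iff)
  have "60 * s ^ 5 \<le> card D" using "0.prems"(5) by simp
  from permutation_twins[OF "0.prems"(1) _ _ this, of "y a" "y b"] "0.prems"(4) I
  obtain T \<phi> where "shift_map D T \<phi>" "card T = s ^ 3"
    "\<forall>e\<in>T. \<forall>f\<in>T. (y a e < y a f \<longleftrightarrow> y a (\<phi> e) < y a (\<phi> f)) \<and>
       (y b e < y b f \<longleftrightarrow> y b (\<phi> e) < y b (\<phi> f))" by auto
  then show ?case unfolding I by (intro exI[of _ T] exI[of _ \<phi>]) simp
next
  case (Suc k)
  obtain a I' where I: "I = insert a I'" "a \<notin> I'" "card I' = Suc (Suc k)"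
    using Suc.prems(3) by (metis card_Suc_eq)
  then obtain b where b: "b \<in> I'" by (metis card.empty ex_in_conv nat.distinct(1))
  have "((60 * s ^ 5) ^ (2 ^ k)) ^ 2 \<le> card D" using Suc.prems(5) by (simp only: power_Suc power_even_eq)
  from erdos_szekeres[OF Suc.prems(1) _ _ this, of "y b" "y a"] Suc.prems(4) I(1) b
  obtain Q where Q: "Q \<subseteq> D" "card Q = (60 * s ^ 5) ^ (2 ^ k)"
    and mono: "(\<forall>u\<in>Q. \<forall>v\<in>Q. y a u < y a v \<longleftrightarrow> y b u < y b v) \<or>
      (\<forall>u\<in>Q. \<forall>v\<in>Q. y a u < y a v \<longleftrightarrow> y b v < y b u)" by auto
  have "finite Q" "finite I'" using Q(1) I(1) Suc.prems(1,2) finite_subset by auto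
  moreover have "inj_on (y q) Q" if "q \<in> I'" for q
    using Suc.prems(4)[of q] I(1) Q(1) that inj_on_subset by blast
  ultimately obtain T \<phi> where T: "shift_map Q T \<phi>" "card T = s ^ 3"
    and pres: "\<And>q e f. q \<in> I' \<Longrightarrow> e \<in> T \<Longrightarrow> f \<in> T \<Longrightarrow> y q e < y q f \<longleftrightarrow> y q (\<phi> e) < y q (\<phi> f)"
    using Suc.IH[of Q I'] I(3) Q(2) by auto
  have "y a e < y a f \<longleftrightarrow> y a (\<phi> e) < y a (\<phi> f)" if "e \<in> T" "f \<in> T" for e f
  proof -
    have "e \<in> Q" "f \<in> Q" "\<phi> e \<in> Q" "\<phi> f \<in> Q" using T(1) that by (auto simp: shift_map_def)
    then show ?thesis using mono pres[OF b that] pres[OF b that(2,1)] by metis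
  qed
  then show ?case using T pres shift_map_mono[OF T(1) Q(1)] I(1) by blast
qed

lemma sum_card_swap:
  fixes A B :: "'a set"
  assumes "finite A" "finite B"
  shows "(\<Sum>e\<in>A. card {f\<in>B. R e f}) = (\<Sum>f\<in>B. card {e\<in>A. R e f})"
proof -
  have count: "card {f\<in>C. P f} = (\<Sum>f\<in>C. if P f then 1 else 0)" if "finite C" for C :: "'a set" and P
    using that by (simp only: card_eq_sum sum.inter_filter)
  have "(\<Sum>e\<in>A. card {f\<in>B. R e f}) = (\<Sum>e\<in>A. \<Sum>f\<in>B. if R e f then 1 else 0)"
    by (simp only: count[OF assms(2)])
  also have "\<dots> = (\<Sum>f\<in>B. \<Sum>e\<in>A. if R e f then 1 else 0)" by (rule sum.swap)
  also have "\<dots> = (\<Sum>f\<in>B. card {e\<in>A. R e f})" by (simp only: count[OF assms(1)])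
  finally show ?thesis .
qed

text \<open>In-degrees and out-degrees have the same sum, so some \<open>f\<close> has in-degree at
  most \<open>d\<close>. Choose it, discard its at most \<open>2 * d\<close> neighbours and
  continue: each chosen element uses up at most \<open>2 * d + 1\<close> elements.\<close>

lemma independent_set_of_outdegree:
  assumes "finite E" "\<And>e. e \<in> E \<Longrightarrow> card {f\<in>E. f \<noteq> e \<and> R e f} \<le> d"
  shows "\<exists>D\<subseteq>E. card E \<le> (2 * d + 1) * card D \<and> (\<forall>e\<in>D. \<forall>f\<in>D. e \<noteq> f \<longrightarrow> \<not> R e f)"
  using assms
proof (induction E rule: finite_psubset_induct)
  case (psubset E)
  show ?case
  proof (cases "E = {}")
    case False
    have "\<exists>f\<in>E. card {e\<in>E. f \<noteq> e \<and> R e f} \<le> d"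
    proof (rule ccontr)
      assume "\<not> ?thesis"
      then have "card E * Suc d \<le> (\<Sum>f\<in>E. card {e\<in>E. f \<noteq> e \<and> R e f})"
        using sum_bounded_below[of E "Suc d" "\<lambda>f. card {e\<in>E. f \<noteq> e \<and> R e f}"] by force
      also have "\<dots> = (\<Sum>e\<in>E. card {f\<in>E. f \<noteq> e \<and> R e f})"
        using sum_card_swap[OF psubset.hyps(1) psubset.hyps(1), of "\<lambda>e f. f \<noteq> e \<and> R e f"] by simp
      also have "\<dots> \<le> card E * d"
        using sum_bounded_above[of E "\<lambda>e. card {f\<in>E. f \<noteq> e \<and> R e f}" d] psubset.prems by simp
      finally show False using False psubset.hyps(1) by simp
    qed
    then obtain f where f: "f \<in> E" "card {e\<in>E. f \<noteq> e \<and> R e f} \<le> d" by blast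
    define X where "X = insert f ({e\<in>E. f \<noteq> e \<and> R e f} \<union> {e\<in>E. e \<noteq> f \<and> R f e})"
    have X: "X \<subseteq> E" "finite X" using f(1) psubset.hyps(1) by (auto simp: X_def)
    have "card X \<le> Suc (card ({e\<in>E. f \<noteq> e \<and> R e f} \<union> {e\<in>E. e \<noteq> f \<and> R f e}))"
      unfolding X_def by (rule card_insert_le_m1) auto
    also have "\<dots> \<le> Suc (d + d)"
      using card_Un_le[of "{e\<in>E. f \<noteq> e \<and> R e f}" "{e\<in>E. e \<noteq> f \<and> R f e}"] f psubset.prems[of f] by simp
    finally have cX: "card X \<le> 2 * d + 1" by simp
    have "E - X \<subset> E" using f(1) by (auto simp: X_def)
    moreover have "card {g\<in>E - X. g \<noteq> e \<and> R e g} \<le> d" if "e \<in> E - X" for e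
    proof -
      have "card {g\<in>E - X. g \<noteq> e \<and> R e g} \<le> card {g\<in>E. g \<noteq> e \<and> R e g}"
        using psubset.hyps(1) by (intro card_mono) auto
      then show ?thesis using psubset.prems[of e] that by simp
    qed
    ultimately obtain D where D: "D \<subseteq> E - X" "card (E - X) \<le> (2 * d + 1) * card D"
      and ind: "\<forall>e\<in>D. \<forall>f\<in>D. e \<noteq> f \<longrightarrow> \<not> R e f" using psubset.IH[of "E - X"] by blast
    have "f \<notin> D" "finite D" using D(1) psubset.hyps(1) finite_subset by (auto simp: X_def)
    then have "card (insert f D) = Suc (card D)" by simp
    moreover have "card E = card (E - X) + card X"
      using X psubset.hyps(1) by (metis card_Diff_subset card_mono le_add_diff_inverse2)
    ultimately have "card E \<le> (2 * d + 1) * card (insert f D)" using D(2) cX by simp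
    moreover have "\<not> R e f \<and> \<not> R f e" if "e \<in> D" for e
      using that D(1) by (auto simp: X_def)
    ultimately show ?thesis using D(1) f(1) ind
      by (intro exI[of _ "insert f D"]) auto
  qed auto
qed

section \<open>Twins in ordered matchings\<close>

text \<open>Coordinates for a matching: \<open>x i e\<close> stands for the \<open>i\<close>-th
  smallest vertex of \<open>e\<close>, counted from 0. Each fixed \<open>i\<close> then gives an
  order on the edges, which links matchings to permutations.\<close>

locale matching_family =
  fixes r :: nat and E :: "'e set" and x :: "nat \<Rightarrow> 'e \<Rightarrow> nat"
  assumes finite_edges: "finite E"
    and vertices_distinct: "i < r \<Longrightarrow> j < r \<Longrightarrow> e \<in> E \<Longrightarrow> f \<in> E \<Longrightarrow> x i e = x j f \<Longrightarrow> i = j \<and> e = f"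
    and vertices_increasing: "i < j \<Longrightarrow> j < r \<Longrightarrow> e \<in> E \<Longrightarrow> x i e < x j e"
begin

text \<open>Amounts to a single cut of the line passing between the vertices \<open>i\<close> and
  \<open>Suc i\<close> of every edge in \<open>D\<close>.\<close>

definition pierced :: "'e set \<Rightarrow> nat \<Rightarrow> bool" where
  "pierced D i \<longleftrightarrow> (\<forall>e\<in>D. \<forall>f\<in>D. x i e < x (Suc i) f)"

text \<open>\<open>S\<close> is meant to hold the gaps already pierced, so a hit is a vertex of
  \<open>e\<close> in an unpierced gap of \<open>f\<close>. The relation need not be symmetric,
  which is why independent sets are found through out-degrees.\<close>

definition gap_hit :: "nat set \<Rightarrow> 'e \<Rightarrow> 'e \<Rightarrow> bool" where
  "gap_hit S e f \<longleftrightarrow> (\<exists>j<r. \<exists>i. Suc i < r \<and> i \<notin> S \<and> x i f < x j e \<and> x j e < x (Suc i) f)"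

definition order_preserving :: "'e set \<Rightarrow> ('e \<Rightarrow> 'e) \<Rightarrow> bool" where
  "order_preserving T \<phi> \<longleftrightarrow>
     (\<forall>e\<in>T. \<forall>f\<in>T. \<forall>i<r. \<forall>j<r. x i e < x j f \<longleftrightarrow> x i (\<phi> e) < x j (\<phi> f))"

definition has_twins :: "'e set \<Rightarrow> nat \<Rightarrow> bool" where
  "has_twins D m \<longleftrightarrow> (\<exists>T \<phi>. shift_map D T \<phi> \<and> order_preserving T \<phi> \<and> m \<le> card T)"

lemma vertices_mono: "i \<le> j \<Longrightarrow> j < r \<Longrightarrow> e \<in> E \<Longrightarrow> x i e \<le> x j e"
  using vertices_increasing[of i j e] by (cases "i = j") auto

lemma has_twins_mono: "has_twins D m \<Longrightarrow> D \<subseteq> D' \<Longrightarrow> m' \<le> m \<Longrightarrow> has_twins D' m'"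
  unfolding has_twins_def by (meson order_trans shift_map_mono)

text \<open>The gaps of \<open>e\<close> from \<open>q\<close> to \<open>i\<close> contain no vertex
  of \<open>f\<close>, so a vertex of \<open>f\<close> has all of the vertices \<open>q\<close> to
  \<open>i\<close> of \<open>e\<close> on the same side.\<close>

lemma block_order:
  assumes D: "D \<subseteq> E" "e \<in> D" "f \<in> D" "e \<noteq> f"
    and hit: "\<not> gap_hit S f e" and j: "j < r"
    and qi: "q \<le> i" "i < r" "\<And>g. q \<le> g \<Longrightarrow> g < i \<Longrightarrow> g \<notin> S"
  shows "x i e < x j f \<longleftrightarrow> x q e < x j f"
  using qi
proof (induction i rule: dec_induct)
  case (step i)
  have "x i e < x (Suc i) e" using vertices_increasing step.prems D by auto
  moreover have "x (Suc i) e \<noteq> x j f" using vertices_distinct[of "Suc i" j e f] step.prems D j by auto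
  moreover have "\<not> (x i e < x j f \<and> x j f < x (Suc i) e)"
    using hit step.prems(1) step.prems(2)[of i] step.hyps j unfolding gap_hit_def by auto
  ultimately have "x (Suc i) e < x j f \<longleftrightarrow> x i e < x j f" by linarith
  then show ?case using step by simp
qed simp

text \<open>The gaps in \<open>S\<close> cut the indices into blocks; \<open>q\<close> is the first
  index of the block of \<open>i\<close>, either 0 or the successor of the last gap of
  \<open>S\<close> below \<open>i\<close>.\<close>

lemma block_start:
  "\<exists>q\<in>insert 0 (Suc ` S). q \<le> i \<and> (\<forall>g. q \<le> g \<longrightarrow> g < i \<longrightarrow> g \<notin> S)"
proof (induction i)
  case (Suc i)
  show ?case
  proof (cases "i \<in> S")
    case False
    with Suc obtain q where "q\<in>insert 0 (Suc ` S)" "q \<le> i" "\<forall>g. q \<le> g \<longrightarrow> g < i \<longrightarrow> g \<notin> S" by blast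
    with False show ?thesis by (intro bexI[of _ q]) (auto simp: less_Suc_eq)
  next
    case True
    then show ?thesis by (intro bexI[of _ "Suc i"]) auto
  qed
qed auto

text \<open>Pierced gaps settle comparisons between different blocks by index alone. Within a block,
  distinct edges compare as their first vertices there do, so it suffices to preserve the
  \<open>Suc (Suc k)\<close> orders given by the block starts.\<close>

lemma twins_of_gap_free:
  assumes D: "D \<subseteq> E" and S: "S \<subseteq> {..<r - 1}" "card S = Suc k" and p: "\<And>i. i \<in> S \<Longrightarrow> pierced D i"
    and free: "\<And>e f. e \<in> D \<Longrightarrow> f \<in> D \<Longrightarrow> e \<noteq> f \<Longrightarrow> \<not> gap_hit S e f"
    and card: "(60 * s ^ 5) ^ (2 ^ k) \<le> card D"
  shows "has_twins D (s ^ 3)"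
proof -
  define I where "I = insert 0 (Suc ` S)"
  have finS: "finite S" using S(1) finite_subset by blast
  then have I: "finite I" "card I = Suc (Suc k)"
    using S(2) by (auto simp: I_def card_image)
  have "S \<noteq> {}" using S(2) by auto
  then have Ir: "q < r" if "q \<in> I" for q using S(1) that by (auto simp: I_def)
  have "inj_on (x q) D" if "q \<in> I" for q
    using vertices_distinct[of q q] Ir[OF that] D by (auto simp: inj_on_def)
  moreover have "finite D" using D finite_edges finite_subset by blast
  ultimately obtain T \<phi> where T: "shift_map D T \<phi>" "card T = s ^ 3"
    and pres: "\<And>q e f. q \<in> I \<Longrightarrow> e \<in> T \<Longrightarrow> f \<in> T \<Longrightarrow> x q e < x q f \<longleftrightarrow> x q (\<phi> e) < x q (\<phi> f)"
    using tuple_twins[OF _ I, of D x s] card by blast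
  have TD: "e \<in> D" "\<phi> e \<in> D" if "e \<in> T" for e using T(1) that by (auto simp: shift_map_def)
  have DE: "e \<in> E" if "e \<in> D" for e using D that by blast
  have cut: "x i e < x j f" if "e \<in> D" "f \<in> D" "i < r" "j < r" "g \<in> S" "i \<le> g" "g < j" for i j e f g
  proof -
    have "x i e \<le> x g e" "x (Suc g) f \<le> x j f" using vertices_mono that DE by auto
    moreover have "x g e < x (Suc g) f" using p that by (auto simp: pierced_def)
    ultimately show ?thesis by linarith
  qed
  have block: "x i e < x j f \<longleftrightarrow> x q e < x q f"
    if "e \<in> D" "f \<in> D" "e \<noteq> f" "i < r" "j < r" "q \<le> i" "q \<le> j"
      "\<And>g. q \<le> g \<Longrightarrow> g < i \<or> g < j \<Longrightarrow> g \<notin> S" for i j q e f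
  proof -
    \<comment> \<open>Both vertices move to the block start, one after the other.
      \<open>block_order\<close> moves the left side of a comparison, so the second move is made on
      the reversed one.\<close>
    have "x i e < x j f \<longleftrightarrow> x q e < x j f"
      using block_order[of D e f S j q i] D that free by auto
    moreover have "x j f < x q e \<longleftrightarrow> x q f < x q e"
      using block_order[of D f e S q q j] D that free by auto
    moreover have "x j f \<noteq> x q e" "x q f \<noteq> x q e"
      using vertices_distinct[of j q f e] vertices_distinct[of q q f e] that DE by auto
    ultimately show ?thesis by linarith
  qed
  have "x i e < x j f \<longleftrightarrow> x i (\<phi> e) < x j (\<phi> f)"
    if ef: "e \<in> T" "f \<in> T" and ij: "i < r" "j < r" for e f i j
  proof -
    consider "e = f" | g where "g \<in> S" "i \<le> g" "g < j" | g where "g \<in> S" "j \<le> g" "g < i"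
      | "e \<noteq> f" "\<And>g. i \<le> g \<Longrightarrow> g < j \<Longrightarrow> g \<notin> S" "\<And>g. j \<le> g \<Longrightarrow> g < i \<Longrightarrow> g \<notin> S" by blast
    then show ?thesis
    proof cases
      case 1
      have "x i e < x j e \<longleftrightarrow> i < j" if "e \<in> E" for e
        using vertices_increasing[of i j e] vertices_increasing[of j i e] ij that
        by (cases i j rule: linorder_cases) auto
      then show ?thesis using 1 TD ef DE by simp
    next
      case 2
      then show ?thesis using cut TD ef ij by blast
    next
      case 3
      then show ?thesis using cut[of f e j i g] cut[of "\<phi> f" "\<phi> e" j i g] TD ef ij by simp
    next
      case 4
      obtain q where q: "q \<in> I" "q \<le> min i j" "\<And>g. q \<le> g \<Longrightarrow> g < min i j \<Longrightarrow> g \<notin> S"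
        using block_start[of S "min i j"] unfolding I_def by blast
      have q': "g \<notin> S" if "q \<le> g" "g < i \<or> g < j" for g
        using q(3)[OF that(1)] 4(2,3)[of g] that(2) by (meson min_less_iff_conj not_le)
      have "\<phi> e \<noteq> \<phi> f" using T(1) ef 4(1) by (auto simp: shift_map_def inj_on_def)
      then show ?thesis
        using block[of e f i j q] block[of "\<phi> e" "\<phi> f" i j q] TD ef ij 4(1) q(2) q' pres[OF q(1) ef]
        by simp
    qed
  qed
  then show ?thesis using T unfolding has_twins_def order_preserving_def by (metis order_refl)
qed

text \<open>Each induction step adds a gap to \<open>S\<close>. The factor for \<open>w\<close> pays
  for the stage with \<open>w\<close> pierced gaps: either conflicts are sparse and an independent
  set is gap-free, or one vertex pierces a further gap of many edges.\<close>

lemma twins_of_pierced: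
  assumes "D \<subseteq> E" "S \<subseteq> {..<r - 1}" "S \<noteq> {}" "\<And>i. i \<in> S \<Longrightarrow> pierced D i" "s > 0"
    and "(\<Prod>w=card S..<r. 3 * r ^ 2 * (60 * s ^ 5) ^ (2 ^ (w - 1))) \<le> card D"
  shows "has_twins D (s ^ 3)"
  using assms
proof (induction "r - card S" arbitrary: D S rule: less_induct)
  case less
  define u where "u = card S"
  have finS: "finite S" and finD: "finite D"
    using less.prems(1,2) finite_edges finite_subset by blast+
  have u: "0 < u" using less.prems(3) finS by (auto simp: u_def)
  have ur: "u < r" using card_mono[OF _ less.prems(2)] u unfolding u_def by simp
  define m where "m = (60 * s ^ 5) ^ (2 ^ (u - 1))"
  \<comment> \<open>\<open>N\<close> is the demand of the next stage, and \<open>q\<close>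
    multiplies it by \<open>r ^ 2\<close> for a pigeonhole over pairs of a vertex index and a gap.
    The factor 3 absorbs \<open>2 * q + 1 \<le> 3 * q\<close>.\<close>
  define N where "N = (\<Prod>w=Suc u..<r. 3 * r ^ 2 * (60 * s ^ 5) ^ (2 ^ (w - 1)))"
  define q where "q = r ^ 2 * N"
  have "m > 0" "q > 0" using less.prems(5) ur by (auto simp: m_def N_def q_def intro!: prod_pos)
  have N: "3 * q * m \<le> card D"
    using less.prems(6) prod.atLeast_Suc_lessThan[OF ur, of "\<lambda>w. 3 * r ^ 2 * (60 * s ^ 5) ^ (2 ^ (w - 1))"]
    by (simp add: u_def m_def N_def q_def mult_ac)
  show ?case
  proof (cases "\<forall>e\<in>D. card {f\<in>D. f \<noteq> e \<and> gap_hit S e f} \<le> q")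
    case True
    then obtain D' where D': "D' \<subseteq> D" "card D \<le> (2 * q + 1) * card D'"
      and free: "\<And>e f. e \<in> D' \<Longrightarrow> f \<in> D' \<Longrightarrow> e \<noteq> f \<Longrightarrow> \<not> gap_hit S e f"
      using independent_set_of_outdegree[OF finD, of "gap_hit S" q] by blast
    have "m \<le> card D'"
    proof (rule ccontr)
      assume "\<not> m \<le> card D'"
      then have "3 * q * card D' < 3 * q * m" using \<open>q > 0\<close> by simp
      moreover have "(2 * q + 1) * card D' \<le> 3 * q * card D'"
        using \<open>q > 0\<close> by (intro mult_right_mono) auto
      ultimately show False using D'(2) N by linarith
    qed
    moreover have "pierced D' i" if "i \<in> S" for i
      using less.prems(4)[OF that] D'(1) by (auto simp: pierced_def)
    ultimately have "has_twins D' (s ^ 3)"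
      using twins_of_gap_free[of D' S "u - 1" s] D'(1) less.prems(1,2) free u by (auto simp: u_def m_def)
    then show ?thesis using D'(1) has_twins_mono by blast
  next
    case False
    then obtain e where e: "e \<in> D" "q < card {f\<in>D. f \<noteq> e \<and> gap_hit S e f}" by force
    define K where "K = {f\<in>D. f \<noteq> e \<and> gap_hit S e f}"
    \<comment> \<open>The pair records a vertex index of \<open>e\<close> and the gap of
      \<open>f\<close> hit by that vertex. Fixing it leaves more than \<open>N\<close> edges whose
      gap \<open>i\<close> contains one and the same vertex of \<open>e\<close>, so that gap becomes
      pierced.\<close>
    have "\<forall>f\<in>K. \<exists>p. fst p < r \<and> Suc (snd p) < r \<and> snd p \<notin> S \<and>
        x (snd p) f < x (fst p) e \<and> x (fst p) e < x (Suc (snd p)) f"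
      by (fastforce simp: K_def gap_hit_def)
    then obtain p where p: "\<And>f. f \<in> K \<Longrightarrow> fst (p f) < r \<and> Suc (snd (p f)) < r \<and> snd (p f) \<notin> S \<and>
        x (snd (p f)) f < x (fst (p f)) e \<and> x (fst (p f)) e < x (Suc (snd (p f))) f"
      by metis
    have "p f \<in> {..<r} \<times> {..<r}" if "f \<in> K" for f using p[OF that] by (simp add: mem_Times_iff)
    then have "p ` K \<subseteq> {..<r} \<times> {..<r}" by blast
    moreover have "card ({..<r} \<times> {..<r}) * N < card K" using e(2) by (simp add: K_def q_def power2_eq_square)
    moreover have "finite K" using finD by (simp add: K_def)
    ultimately obtain c where c: "N < card {f\<in>K. p f = c}"
      using pigeonhole_fibre[of K "{..<r} \<times> {..<r}" p N] by auto
    define F where "F = {f\<in>K. p f = c}"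
    define i where "i = snd c"
    have F: "F \<subseteq> D" by (auto simp: F_def K_def)
    have "F \<noteq> {}" using c unfolding F_def[symmetric] by auto
    then obtain f where "f \<in> F" by blast
    then have i: "Suc i < r" "i \<notin> S" using p[of f] by (auto simp: F_def i_def)
    have "x i f < x (Suc i) f'" if "f \<in> F" "f' \<in> F" for f f'
      using p[of f] p[of f'] that by (auto simp: F_def i_def)
    then have pF: "pierced F j" if "j \<in> insert i S" for j
      using that less.prems(4)[of j] subsetD[OF F] by (auto simp: pierced_def)
    have cS: "card (insert i S) = Suc u" using i(2) finS by (simp add: u_def)
    have "has_twins F (s ^ 3)"
    proof (rule less.hyps)
      show "r - card (insert i S) < r - card S" using cS ur u_def by linarith
      show "insert i S \<subseteq> {..<r - 1}" using i(1) less.prems(2) by auto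
      show "(\<Prod>w=card (insert i S)..<r. 3 * r ^ 2 * (60 * s ^ 5) ^ (2 ^ (w - 1))) \<le> card F"
        using c by (simp add: cS N_def F_def)
    qed (use F less.prems pF in auto)
    then show ?thesis using F has_twins_mono by blast
  qed
qed

end

section \<open>Exponents, costs and elementary estimates\<close>

definition twin_exponent :: "nat \<Rightarrow> real" where
  "twin_exponent r = 3 / 5 * (1 / (2 ^ (r - 1) - 1))"

text \<open>The constant left in the product of \<open>twins_of_pierced\<close> for a single pierced
  gap once the power of \<open>s\<close> is split off.\<close>

definition twin_cost :: "nat \<Rightarrow> nat" where
  "twin_cost r = (3 * r ^ 2) ^ (r - 1) * 60 ^ (2 ^ (r - 1) - 1)"

lemma prod_cost:
  fixes b M :: nat
  shows "(\<Prod>w=1..<Suc n. b * M ^ (2 ^ (w - 1))) = b ^ n * M ^ (2 ^ n - 1)"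
proof (induction n)
  case (Suc n)
  have "2 ^ Suc n - 1 = (2 ^ n - 1) + (2 ^ n :: nat)" by simp
  then have "M ^ (2 ^ Suc n - 1) = M ^ (2 ^ n - 1) * M ^ (2 ^ n)" by (simp only: power_add)
  moreover have "(\<Prod>w=1..<Suc (Suc n). b * M ^ (2 ^ (w - 1))) =
      (\<Prod>w=1..<Suc n. b * M ^ (2 ^ (w - 1))) * (b * M ^ (2 ^ n))"
    by (subst prod.atLeastLessThan_Suc) auto
  ultimately show ?case using Suc.IH by (simp add: mult_ac)
qed simp

text \<open>The last equation explains the exponent: with one pierced gap the cost grows like
  \<open>s\<close> to the power \<open>5 * (2 ^ (r - 1) - 1)\<close>, while the twins have size
  \<open>s ^ 3\<close>. The bound \<open>3 / 5\<close> is the value for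
  \<open>r = 2\<close>.\<close>

lemma twin_exponent_bounds:
  assumes "r \<ge> 2"
  shows "0 < twin_exponent r" "twin_exponent r \<le> 3 / 5"
    "real (5 * (2 ^ (r - 1) - 1)) * twin_exponent r = 3"
proof -
  have "(2::real) ^ 1 \<le> 2 ^ (r - 1)" using assms by (intro power_increasing) auto
  then have *: "(2::real) ^ (r - 1) - 1 \<ge> 1" by simp
  then show "0 < twin_exponent r" by (simp add: twin_exponent_def)
  have "1 / ((2::real) ^ (r - 1) - 1) \<le> 1" using * by (simp add: divide_le_eq_1)
  then have "3 / 5 * (1 / ((2::real) ^ (r - 1) - 1)) \<le> 3 / 5 * 1" by (intro mult_left_mono) auto
  then show "twin_exponent r \<le> 3 / 5" unfolding twin_exponent_def by linarith
  have "real (5 * (2 ^ (r - 1) - 1)) = 5 * ((2::real) ^ (r - 1) - 1)" by (simp add: of_nat_diff)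
  moreover have "5 * q * (3 / 5 * (1 / q)) = 3" if "1 \<le> q" for q :: real using that by simp
  ultimately show "real (5 * (2 ^ (r - 1) - 1)) * twin_exponent r = 3"
    using * unfolding twin_exponent_def by metis
qed

text \<open>By injectivity, raising \<open>p\<close> by one adds at most one element, so the least
  \<open>p\<close> whose count reaches \<open>k\<close> does not overshoot.\<close>

lemma ex_cut_of_card:
  fixes g :: "'a \<Rightarrow> nat"
  assumes fin: "finite D" and inj: "inj_on g D" and k: "k \<le> card D"
  shows "\<exists>p. card {e\<in>D. g e < p} = k"
proof -
  define c where "c p = card {e\<in>D. g e < p}" for p
  define p where "p = (LEAST p. k \<le> c p)"
  have "finite (g ` D)" using fin by simp
  then obtain b where "\<forall>e\<in>D. g e < b" by (metis finite_nat_set_iff_bounded imageI)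
  then have "{e\<in>D. g e < b} = D" by auto
  then have "k \<le> c b" using k by (simp add: c_def)
  then have ge: "k \<le> c p" unfolding p_def by (rule LeastI)
  have "c p \<le> k"
  proof (cases p)
    case 0
    then show ?thesis by (simp add: c_def)
  next
    case (Suc p')
    then have "\<not> k \<le> c p'" using not_less_Least[of p' "\<lambda>p. k \<le> c p"] by (simp add: p_def)
    moreover have "c p \<le> c p' + card {e\<in>D. g e = p'}"
    proof -
      have "{e\<in>D. g e < p} = {e\<in>D. g e < p'} \<union> {e\<in>D. g e = p'}" using Suc by auto
      then show ?thesis using card_Un_le by (simp add: c_def)
    qed
    moreover have "card {e\<in>D. g e = p'} \<le> 1"
      using card_le_Suc0_iff_eq[of "{e\<in>D. g e = p'}"] fin inj by (auto simp: inj_on_def)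
    ultimately show ?thesis by linarith
  qed
  then show ?thesis using ge by (auto simp: c_def)
qed

text \<open>The constant \<open>13/20\<close> only has to exceed the root \<open>0.618\<dots>\<close> of \<open>z\<^sup>2 + z = 1\<close>.\<close>

lemma powr_quarter_half:
  fixes \<beta> :: real
  assumes "0 < \<beta>" "\<beta> \<le> 3 / 5"
  shows "1 \<le> (1 / 4) powr \<beta> + (1 / 2) powr \<beta>"
proof -
  define z where "z = (1 / 2 :: real) powr \<beta>"
  \<comment> \<open>The rational inequality \<open>(13/20) ^ 5 \<le> (1/2) ^ 3\<close> bounds
    \<open>(1/2) powr (3/5)\<close> from below; a smaller exponent only increases a power of
    \<open>1/2\<close>.\<close>
  have "13 / 20 = ((13 / 20 :: real) powr 5) powr (1 / 5)" by (subst powr_powr) simp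
  also have "(13 / 20 :: real) powr 5 = (13 / 20) ^ 5" by simp
  also have "((13 / 20 :: real) ^ 5) powr (1 / 5) \<le> ((1 / 2) ^ 3) powr (1 / 5)"
    by (intro powr_mono2) (auto simp: power_divide)
  also have "(1 / 2 :: real) ^ 3 = (1 / 2) powr 3" by simp
  also have "((1 / 2 :: real) powr 3) powr (1 / 5) = (1 / 2) powr (3 / 5)" by (subst powr_powr) simp
  also have "\<dots> \<le> z" unfolding z_def using assms by (intro powr_mono') auto
  finally have z: "13 / 20 \<le> z" .
  have "(1 / 4 :: real) powr \<beta> = (1 / 2 * (1 / 2)) powr \<beta>" by simp
  also have "\<dots> = z * z" unfolding z_def by (rule powr_mult)
  finally have "(1 / 4 :: real) powr \<beta> = z * z" .
  moreover have "13 / 20 * (13 / 20) \<le> z * z" using z by (intro mult_mono) auto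
  ultimately show ?thesis using z by (simp add: z_def)
qed

section \<open>Twins without a gap pierced in advance\<close>

context matching_family
begin

text \<open>Within a single edge the indices alone decide comparisons, so any edge can be mapped to
  any other. This settles small families and the case \<open>s = 0\<close> of the general
  bound.\<close>

lemma has_twins_one:
  assumes "D \<subseteq> E" "2 \<le> card D"
  shows "has_twins D 1"
proof -
  obtain e f where ef: "e \<in> D" "f \<in> D" "e \<noteq> f" using assms(2) by (meson card_2_iff' obtain_subset_with_card_n subsetD)
  have "x i e < x j e \<longleftrightarrow> i < j" if "e \<in> E" "i < r" "j < r" for i j e
    using vertices_increasing[of i j e] vertices_increasing[of j i e] that
    by (cases i j rule: linorder_cases) auto
  moreover have "e \<in> E" "f \<in> E" using ef assms(1) by auto
  ultimately show ?thesis unfolding has_twins_def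
    using ef by (intro exI[of _ "{e}"] exI[of _ "\<lambda>_. f"])
      (auto simp: shift_map_def order_preserving_def)
qed

text \<open>\<open>A\<close> lies entirely to the left of \<open>B\<close> and each map stays on its
  side, so gluing the two maps leaves mixed comparisons unchanged.\<close>

lemma has_twins_append:
  assumes AB: "A \<subseteq> E" "B \<subseteq> E" and r: "r > 0"
    and less: "\<And>e f i j. e \<in> A \<Longrightarrow> f \<in> B \<Longrightarrow> i < r \<Longrightarrow> j < r \<Longrightarrow> x i e < x j f"
    and "has_twins A m" "has_twins B m'"
  shows "has_twins (A \<union> B) (m + m')"
proof -
  obtain T \<phi> where T: "shift_map A T \<phi>" "order_preserving T \<phi>" "m \<le> card T"
    using assms(5) by (auto simp: has_twins_def)
  obtain T' \<phi>' where T': "shift_map B T' \<phi>'" "order_preserving T' \<phi>'" "m' \<le> card T'"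
    using assms(6) by (auto simp: has_twins_def)
  have TA: "T \<subseteq> A" "\<phi> ` T \<subseteq> A" "T' \<subseteq> B" "\<phi>' ` T' \<subseteq> B" using T T' by (auto simp: shift_map_def)
  have "A \<inter> B = {}"
  proof (rule equals0I)
    fix e assume "e \<in> A \<inter> B"
    then show False using less[of e e 0 0] r by simp
  qed
  then have disj: "(T \<union> \<phi> ` T) \<inter> (T' \<union> \<phi>' ` T') = {}" using TA by blast
  define \<psi> where "\<psi> e = (if e \<in> T then \<phi> e else \<phi>' e)" for e
  have "shift_map (A \<union> B) (T \<union> T') \<psi>"
    unfolding \<psi>_def by (rule shift_map_union[OF T(1) T'(1) disj])
  moreover have "m + m' \<le> card (T \<union> T')"
  proof -
    have "finite T" "finite T'" using TA AB finite_edges by (meson finite_subset order_trans)+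
    moreover have "T \<inter> T' = {}" using disj by blast
    ultimately show ?thesis using T(3) T'(3) by (simp add: card_Un_disjoint)
  qed
  moreover have "order_preserving (T \<union> T') \<psi>"
    unfolding order_preserving_def
  proof (intro ballI allI impI)
    fix e f i j assume ef: "e \<in> T \<union> T'" "f \<in> T \<union> T'" and ij: "i < r" "j < r"
    have psi: "\<psi> e = \<phi> e" if "e \<in> T" for e using that by (simp add: \<psi>_def)
    have psi': "\<psi> e = \<phi>' e" if "e \<in> T'" for e using that disj by (auto simp: \<psi>_def)
    have sep: "x i e < x j f" "x i (\<psi> e) < x j (\<psi> f)" if "e \<in> T" "f \<in> T'" "i < r" "j < r" for e f i j
    proof -
      have "e \<in> A" "\<phi> e \<in> A" "f \<in> B" "\<phi>' f \<in> B" using that TA by auto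
      then show "x i e < x j f" "x i (\<psi> e) < x j (\<psi> f)" using less that psi psi' by simp_all
    qed
    consider "e \<in> T" "f \<in> T" | "e \<in> T'" "f \<in> T'" | "e \<in> T" "f \<in> T'" | "e \<in> T'" "f \<in> T"
      using ef by blast
    then show "x i e < x j f \<longleftrightarrow> x i (\<psi> e) < x j (\<psi> f)"
    proof cases
      case 1
      then show ?thesis using T(2) ij by (simp add: psi order_preserving_def)
    next
      case 2
      then show ?thesis using T'(2) ij by (simp add: psi' order_preserving_def)
    next
      case 3
      then show ?thesis using sep[of e f i j] ij by simp
    next
      case 4
      then show ?thesis using sep[of f e j i] ij by simp
    qed
  qed
  ultimately show ?thesis unfolding has_twins_def by blast
qed

text \<open>\<open>s\<close> is the largest number whose cost \<open>K * s ^ a\<close> fits into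
  \<open>card D\<close>. That \<open>Suc s\<close> no longer fits, raised to the power
  \<open>\<beta>\<close>, is the inequality, since \<open>a * \<beta> = 3\<close>.\<close>

lemma twins_of_one_pierced:
  assumes r: "r \<ge> 2" and D: "D \<subseteq> E" "i < r - 1" "pierced D i"
  shows "\<exists>s. has_twins D (s ^ 3) \<and>
    real (card D) powr twin_exponent r \<le> real (twin_cost r) powr twin_exponent r * real (Suc s) ^ 3"
proof -
  define a where "a = 5 * (2 ^ (r - 1) - 1 :: nat)"
  define K where "K = twin_cost r"
  define n where "n = card D"
  have K: "K > 0" using r by (auto simp: K_def twin_cost_def)
  have "(2::nat) ^ 1 \<le> 2 ^ (r - 1)" using r by (intro power_increasing) auto
  then have a: "a > 0" by (simp add: a_def)
  define s where "s = (LEAST s. n < K * Suc s ^ a)"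
  have "Suc n ^ 1 \<le> Suc n ^ a" using a by (intro power_increasing) auto
  then have "n < Suc n ^ a" by simp
  also have "\<dots> \<le> K * Suc n ^ a" using K by simp
  finally have "n < K * Suc n ^ a" .
  then have less: "n < K * Suc s ^ a" unfolding s_def by (rule LeastI)
  have tw: "has_twins D (s ^ 3)"
  proof (cases s)
    case 0
    show ?thesis unfolding has_twins_def
      by (intro exI[of _ "{}"]) (auto simp: 0 shift_map_def order_preserving_def)
  next
    case (Suc s')
    then have "\<not> n < K * Suc s' ^ a" using not_less_Least[of s' "\<lambda>s. n < K * Suc s ^ a"] by (simp add: s_def)
    then have le: "K * s ^ a \<le> n" using Suc by simp
    have "(\<Prod>w=card {i}..<r. 3 * r ^ 2 * (60 * s ^ 5) ^ (2 ^ (w - 1))) =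
        (3 * r ^ 2) ^ (r - 1) * (60 * s ^ 5) ^ (2 ^ (r - 1) - 1)"
      using prod_cost[of "3 * r ^ 2" "60 * s ^ 5" "r - 1"] r by simp
    also have "\<dots> = K * s ^ a"
      by (simp add: K_def twin_cost_def a_def power_mult_distrib power_mult mult.assoc)
    finally have "(\<Prod>w=card {i}..<r. 3 * r ^ 2 * (60 * s ^ 5) ^ (2 ^ (w - 1))) \<le> card D"
      using le by (simp add: n_def)
    then show ?thesis using twins_of_pierced[of D "{i}" s] D Suc by simp
  qed
  define \<beta> where "\<beta> = twin_exponent r"
  have \<beta>: "0 < \<beta>" "real a * \<beta> = 3" using twin_exponent_bounds[OF r] by (simp_all add: \<beta>_def a_def)
  have "real n \<le> real (K * Suc s ^ a)" using less by (simp only: of_nat_le_iff)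
  then have "real n powr \<beta> \<le> (real K * real (Suc s) ^ a) powr \<beta>"
    using \<beta>(1) by (intro powr_mono2) (auto simp del: of_nat_Suc)
  also have "\<dots> = real K powr \<beta> * (real (Suc s) ^ a) powr \<beta>" by (rule powr_mult)
  also have "(real (Suc s) ^ a) powr \<beta> = (real (Suc s) powr real a) powr \<beta>"
    by (subst powr_realpow) auto
  also have "\<dots> = real (Suc s) powr 3" by (simp only: powr_powr \<beta>(2))
  also have "\<dots> = real (Suc s) ^ 3" using powr_realpow[of "real (Suc s)" 3] by simp
  finally show ?thesis using tw unfolding \<beta>_def n_def K_def by blast
qed

lemma crossed_gap:
  assumes "x 0 e < p" "p \<le> x n e"
  shows "\<exists>i<n. x i e < p \<and> p \<le> x (Suc i) e"
  using assms(2)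
proof (induction n)
  case (Suc n)
  then show ?case by (cases "p \<le> x n e") (auto intro: less_SucI)
qed (use assms(1) in auto)

text \<open>Strong induction, cutting the line where a quarter of the edges lie entirely on the
  left. If an eighth of the edges cross the cut, many cross it in the same gap, which is then
  pierced; otherwise both sides contribute by induction and
  \<open>(1/4) powr \<beta> + (1/2) powr \<beta> \<ge> 1\<close> closes it.\<close>

lemma many_twins:
  assumes r: "r \<ge> 2" and "D \<subseteq> E" "2 \<le> card D"
  shows "\<exists>m. has_twins D m \<and>
    1 / (8 * real (8 * r * twin_cost r) powr twin_exponent r) * real (card D) powr twin_exponent r \<le> real m"
  using assms(2,3)
proof (induction "card D" arbitrary: D rule: less_induct)
  case less
  define \<beta> where "\<beta> = twin_exponent r"
  have \<beta>: "0 < \<beta>" "\<beta> \<le> 3 / 5" using twin_exponent_bounds[OF r] by (simp_all add: \<beta>_def)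
  define K where "K = twin_cost r"
  have K: "K > 0" using r by (auto simp: K_def twin_cost_def)
  \<comment> \<open>Inside the power, \<open>8 * r\<close> covers the edges lost in the crossing
    case and \<open>K\<close> the cost. The outer 8 pays for replacing \<open>s + 1\<close> by
    \<open>2 * s\<close> in a cube and makes twins of size one sufficient when
    \<open>n < 8\<close>.\<close>
  define c where "c = 1 / (8 * real (8 * r * K) powr \<beta>)"
  define n where "n = card D"
  have "1 \<le> 8 * r * K" using K r by simp
  then have "1 \<le> real (8 * r * K)" by linarith
  then have "1 \<le> real (8 * r * K) powr \<beta>" using \<beta>(1) by (intro ge_one_powr_ge_zero) auto
  moreover have "0 < 1 / (8 * y) \<and> 1 / (8 * y) \<le> 1 / 8" if "1 \<le> y" for y :: real
    using that by (simp add: divide_simps)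
  ultimately have c: "0 < c" "c \<le> 1 / 8" unfolding c_def by blast+
  have finD: "finite D" using less.prems(1) finite_edges finite_subset by blast
  have one: "has_twins D 1" using less.prems by (rule has_twins_one)
  have "\<exists>m. has_twins D m \<and> c * real n powr \<beta> \<le> real m"
  proof (cases "n < 8")
    case True
    have "real n powr \<beta> \<le> real n powr 1" using less.prems(2) \<beta> by (intro powr_mono) (auto simp: n_def)
    also have "\<dots> \<le> 8" using True by simp
    finally have "c * real n powr \<beta> \<le> 1 / 8 * 8" using c by (intro mult_mono) auto
    then show ?thesis using one by (intro exI[of _ 1]) simp
  next
    case False
    \<comment> \<open>A quarter rounded up. As \<open>n \<ge> 8\<close>, it is at least 2, so the
      induction hypothesis applies to \<open>A\<close>, and \<open>B\<close> still keeps half of the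
      edges when fewer than an eighth cross.\<close>
    define k where "k = (n + 3) div 4"
    have k: "n \<le> 4 * k" "4 * k \<le> n + 3" "2 \<le> k" "k < n" using False by (auto simp: k_def)
    have inj: "inj_on (x (r - 1)) D"
      using vertices_distinct[of "r - 1" "r - 1"] r less.prems(1) by (auto simp: inj_on_def)
    obtain p where p: "card {e\<in>D. x (r - 1) e < p} = k"
      using ex_cut_of_card[OF finD inj, of k] k by (auto simp: n_def)
    define A where "A = {e\<in>D. x (r - 1) e < p}"
    define B where "B = {e\<in>D. p \<le> x 0 e}"
    define X where "X = {e\<in>D. x 0 e < p \<and> p \<le> x (r - 1) e}"
    have ABX: "A \<subseteq> D" "B \<subseteq> D" "X \<subseteq> D" "finite A" "finite B" "finite X"
      using finD by (auto simp: A_def B_def X_def)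
    have lt: "x i e < x j f" if "e \<in> A" "f \<in> B" "i < r" "j < r" for e f i j
    proof -
      have "x i e \<le> x (r - 1) e" "x 0 f \<le> x j f"
        using vertices_mono that ABX less.prems(1) r by auto
      then show ?thesis using that by (auto simp: A_def B_def)
    qed
    show ?thesis
    proof (cases "n \<le> 8 * card X")
      case True
      then have "card X > 0" using False by simp
      have "\<forall>e\<in>X. \<exists>i. i < r - 1 \<and> x i e < p \<and> p \<le> x (Suc i) e"
        using crossed_gap[of _ p "r - 1"] by (auto simp: X_def)
      then obtain g where g: "\<And>e. e \<in> X \<Longrightarrow> g e < r - 1 \<and> x (g e) e < p \<and> p \<le> x (Suc (g e)) e" by metis
      \<comment> \<open>The largest bound the pigeonhole principle allows with \<open>r\<close>
        classes; exceeding it gives \<open>card X \<le> card F * r\<close> without rounding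
        loss.\<close>
      have "r * ((card X - 1) div r) < card X"
        using \<open>card X > 0\<close> by (metis One_nat_def Suc_pred le_imp_less_Suc times_div_less_eq_dividend)
      moreover have "g ` X \<subseteq> {..<r}" using g by fastforce
      ultimately obtain i where i: "(card X - 1) div r < card {e\<in>X. g e = i}"
        using pigeonhole_fibre[OF ABX(6), of "{..<r}" g "(card X - 1) div r"] by auto
      define F where "F = {e\<in>X. g e = i}"
      have F: "F \<subseteq> D" using ABX by (auto simp: F_def)
      have "card X - 1 < card F * r"
        using i r by (simp add: F_def div_less_iff_less_mult)
      then have "card X \<le> card F * r" by linarith
      then have "8 * card X \<le> 8 * (card F * r)" by simp
      then have nF: "n \<le> 8 * r * card F" using True by (simp add: mult_ac)
      then have "F \<noteq> {}" using False by auto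
      then obtain e where "e \<in> F" by blast
      then have "i < r - 1" using g by (auto simp: F_def)
      moreover have "x i e < x (Suc i) f" if "e \<in> F" "f \<in> F" for e f
        using g[of e] g[of f] that by (auto simp: F_def)
      then have "pierced F i" by (simp add: pierced_def)
      ultimately obtain s where s: "has_twins F (s ^ 3)"
        "real (card F) powr \<beta> \<le> real K powr \<beta> * real (Suc s) ^ 3"
        using twins_of_one_pierced[OF r, of F i] F less.prems(1) unfolding \<beta>_def K_def by blast
      have "real n \<le> real (8 * r) * real (card F)" using nF by (metis of_nat_le_iff of_nat_mult)
      then have "real n powr \<beta> \<le> (real (8 * r) * real (card F)) powr \<beta>"
        using \<beta> by (intro powr_mono2) auto
      also have "\<dots> = real (8 * r) powr \<beta> * real (card F) powr \<beta>" by (rule powr_mult)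
      also have "\<dots> \<le> real (8 * r) powr \<beta> * (real K powr \<beta> * real (Suc s) ^ 3)"
        using s(2) by (intro mult_left_mono) auto
      also have "\<dots> = real (8 * r * K) powr \<beta> * real (Suc s) ^ 3" by (simp add: powr_mult)
      finally have "c * real n powr \<beta> \<le> c * (real (8 * r * K) powr \<beta> * real (Suc s) ^ 3)"
        using c by (intro mult_left_mono) auto
      also have "\<dots> = real (Suc s) ^ 3 / 8"
        using \<open>1 \<le> real (8 * r * K) powr \<beta>\<close> K r by (simp add: c_def)
      \<comment> \<open>The maximum with 1 covers \<open>s = 0\<close>; for \<open>s > 0\<close> one
        has \<open>s + 1 \<le> 2 * s\<close>.\<close>
      also have "\<dots> \<le> real (max 1 (s ^ 3))"
      proof (cases "s = 0")
        case False
        then have "real (Suc s) ^ 3 \<le> (2 * real s) ^ 3" by (intro power_mono) auto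
        then have "real (Suc s) ^ 3 \<le> 8 * real (s ^ 3)" by (simp add: power_mult_distrib)
        moreover have "real (s ^ 3) \<le> real (max 1 (s ^ 3))" by (simp only: of_nat_le_iff max.cobounded2)
        ultimately show ?thesis by linarith
      qed simp
      finally have "c * real n powr \<beta> \<le> real (max 1 (s ^ 3))" .
      moreover have "has_twins D (max 1 (s ^ 3))"
        using one has_twins_mono[OF s(1) F] by (simp add: max_def)
      ultimately show ?thesis by blast
    next
      case crossing: False
      have "D = A \<union> B \<union> X" by (auto simp: A_def B_def X_def)
      then have "n \<le> card A + card B + card X"
        unfolding n_def by (metis add_le_mono1 card_Un_le order_trans)
      then have B: "n \<le> 2 * card B" using crossing k p False by (simp add: A_def)
      have "A \<inter> B = {}"
      proof (rule equals0I)
        fix e assume "e \<in> A \<inter> B"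
        then show False using lt[of e e 0 0] r by simp
      qed
      then have "card A + card B \<le> n"
        using card_mono[OF finD, of "A \<union> B"] ABX by (simp add: card_Un_disjoint n_def)
      then have "card A < n" "card B < n" "2 \<le> card A" "2 \<le> card B"
        using k p B False by (auto simp: A_def)
      then obtain m m' where m: "has_twins A m" "c * real (card A) powr \<beta> \<le> real m"
          "has_twins B m'" "c * real (card B) powr \<beta> \<le> real m'"
        using less.hyps[of A] less.hyps[of B] ABX less.prems(1) unfolding c_def \<beta>_def K_def n_def by blast
      have "has_twins (A \<union> B) (m + m')"
        using m ABX less.prems(1) lt r by (intro has_twins_append) auto
      then have tw: "has_twins D (m + m')" using has_twins_mono[of "A \<union> B"] ABX by simp
      have "real n powr \<beta> * 1 \<le> real n powr \<beta> * ((1 / 4) powr \<beta> + (1 / 2) powr \<beta>)"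
        using powr_quarter_half[OF \<beta>] by (intro mult_left_mono) auto
      also have "\<dots> = (real n * (1 / 4)) powr \<beta> + (real n * (1 / 2)) powr \<beta>"
        by (simp only: distrib_left powr_mult[symmetric])
      also have "\<dots> \<le> real (card A) powr \<beta> + real (card B) powr \<beta>"
        using \<beta> k p B by (intro add_mono powr_mono2) (auto simp: A_def)
      finally have "c * real n powr \<beta> \<le> c * (real (card A) powr \<beta> + real (card B) powr \<beta>)"
        using c by (intro mult_left_mono) auto
      also have "\<dots> \<le> real (m + m')" using m by (simp add: distrib_left)
      finally show ?thesis using tw by blast
    qed
  qed
  then show ?case by (simp add: c_def \<beta>_def K_def n_def)
qed

end

section \<open>From vertex coordinates back to ordered matchings\<close>

lemma sorted_nth_less_iff:
  assumes "finite e" "i < card e" "j < card e"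
  shows "sorted_list_of_set e ! i < sorted_list_of_set e ! j \<longleftrightarrow> i < j"
proof -
  have *: "sorted_list_of_set e ! i < sorted_list_of_set e ! j" if "i < j" "j < card e" for i j
    using sorted_wrt_nth_less[OF strict_sorted_list_of_set that(1), of e] that(2) by simp
  show ?thesis using *[of i j] *[of j i] assms by (cases i j rule: linorder_cases) auto
qed

text \<open>Equal vertices force equal edges by disjointness, and then equal indices because the
  sorted list of an edge is strictly increasing.\<close>

lemma matching_family_sorted:
  fixes M :: "nat set set"
  assumes M: "ordered_matching r n M"
  shows "matching_family r M (\<lambda>i e. sorted_list_of_set e ! i)"
proof
  have fin: "finite e" "card e = r" if "e \<in> M" for e using M that by (auto simp: ordered_matching_def)
  show "finite M" using M by (simp add: ordered_matching_def)
  fix i j e f assume ij: "i < r" "j < r" and ef: "e \<in> M" "f \<in> M"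
    and eq: "sorted_list_of_set e ! i = sorted_list_of_set f ! j"
  have "sorted_list_of_set e ! i \<in> e" "sorted_list_of_set f ! j \<in> f"
    using fin ef ij by (metis length_sorted_list_of_set nth_mem set_sorted_list_of_set)+
  then have "e = f" using M ef eq by (auto simp: ordered_matching_def pairwise_def disjnt_def)
  then show "i = j \<and> e = f" using eq sorted_nth_less_iff[of e i j] sorted_nth_less_iff[of e j i] fin ef ij
    by (metis linorder_neqE_nat less_irrefl)
next
  fix i j e assume "i < j" "j < r" "e \<in> M"
  then show "sorted_list_of_set e ! i < sorted_list_of_set e ! j"
    using M by (intro sorted_nth_less_iff[THEN iffD2]) (auto simp: ordered_matching_def)
qed

text \<open>The edge map lifts to vertices by sending vertex \<open>i\<close> of \<open>e\<close> to
  vertex \<open>i\<close> of \<open>\<phi> e\<close>. Order preservation makes the lift strictly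
  increasing, hence an isomorphism of \<open>T\<close> onto its image.\<close>

lemma has_twins_le_max_twins:
  fixes M :: "nat set set"
  assumes M: "ordered_matching r n M"
    and tw: "matching_family.has_twins r (\<lambda>i e. sorted_list_of_set e ! i) M m"
  shows "m \<le> max_twins M"
proof -
  define x where "x i e = sorted_list_of_set e ! i" for i and e :: "nat set"
  interpret matching_family r M x unfolding x_def by (rule matching_family_sorted[OF M])
  have "has_twins M m" using tw by (simp only: x_def[abs_def])
  then obtain T \<phi> where T: "shift_map M T \<phi>" "order_preserving T \<phi>" "m \<le> card T"
    unfolding has_twins_def by blast
  have finM: "finite M" using M by (simp add: ordered_matching_def)
  have TM: "T \<subseteq> M" "\<phi> ` T \<subseteq> M" and inj\<phi>: "inj_on \<phi> T" and disj: "\<phi> ` T \<inter> T = {}"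
    using T(1) by (auto simp: shift_map_def)
  have edge: "e = (\<lambda>i. x i e) ` {..<r}" if "e \<in> M" for e
  proof -
    have "finite e" "card e = r" using M that by (auto simp: ordered_matching_def)
    then have "set (sorted_list_of_set e) = e" "length (sorted_list_of_set e) = r" by auto
    then show ?thesis unfolding x_def by (metis list.set_map map_nth set_upt atLeast0LessThan)
  qed
  have bij: "bij_betw (\<lambda>(i, e). x i e) ({..<r} \<times> A) (\<Union>A)" if "A \<subseteq> M" for A
  proof -
    have "i = j \<and> e = f" if "i < r" "j < r" "e \<in> A" "f \<in> A" "x i e = x j f" for i j e f
      using vertices_distinct[of i j e f] that \<open>A \<subseteq> M\<close> by auto
    then have "inj_on (\<lambda>(i, e). x i e) ({..<r} \<times> A)"
      unfolding inj_on_def by (auto split: prod.splits)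
    moreover have "(\<lambda>(i, e). x i e) ` ({..<r} \<times> A) = (\<Union>e\<in>A. (\<lambda>i. x i e) ` {..<r})" by auto
    moreover have "\<dots> = \<Union>A" using edge that by (metis (no_types, lifting) SUP_cong SUP_id_eq id_apply image_ident subsetD)
    ultimately show ?thesis by (simp add: bij_betw_def)
  qed
  define V where "V = {..<r} \<times> T"
  define X where "X = (\<lambda>(i, e). x i e)"
  \<comment> \<open>Every vertex of \<open>T\<close> comes from exactly one pair of an index and an
    edge, so inverting \<open>X\<close> on \<open>V\<close> makes the lift well defined.\<close>
  define F where "F = (\<lambda>w. case inv_into V X w of (i, e) \<Rightarrow> x i (\<phi> e))"
  have bT: "bij_betw X V (\<Union>T)" unfolding V_def X_def by (rule bij[OF TM(1)])
  have F: "F (x i e) = x i (\<phi> e)" if "i < r" "e \<in> T" for i e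
  proof -
    have "inv_into V X (X (i, e)) = (i, e)"
      using bij_betw_imp_inj_on[OF bT] that by (intro inv_into_f_f) (auto simp: V_def)
    then show ?thesis by (simp add: F_def X_def)
  qed
  have UT: "\<exists>i e. i < r \<and> e \<in> T \<and> w = x i e" if "w \<in> \<Union>T" for w
  proof -
    have "w \<in> X ` V" using bT that by (simp add: bij_betw_def)
    then show ?thesis by (auto simp: V_def X_def)
  qed
  have Fe: "F ` e = \<phi> e" if "e \<in> T" for e
  proof -
    have "F ` e = F ` (\<lambda>i. x i e) ` {..<r}" using edge[of e] that TM by auto
    also have "\<dots> = (\<lambda>i. x i (\<phi> e)) ` {..<r}" using F that by (simp add: image_image)
    also have "\<dots> = \<phi> e" using edge[of "\<phi> e"] that TM by auto
    finally show ?thesis .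
  qed
  have mono: "strict_mono_on (\<Union>T) F"
  proof (rule strict_mono_onI)
    fix v w assume "v \<in> \<Union>T" "w \<in> \<Union>T" "v < w"
    then obtain i e j f where *: "i < r" "e \<in> T" "v = x i e" "j < r" "f \<in> T" "w = x j f"
      using UT by meson
    then have "x i (\<phi> e) < x j (\<phi> f)" using T(2) \<open>v < w\<close> unfolding order_preserving_def by blast
    then show "F v < F w" using F * by simp
  qed
  have "F ` \<Union>T = \<Union>(\<phi> ` T)" using Fe by (simp add: image_Union)
  then have "bij_betw F (\<Union>T) (\<Union>(\<phi> ` T))"
    using strict_mono_on_imp_inj_on[OF mono] by (simp add: bij_betw_def)
  moreover have "bij_betw ((`) F) T (\<phi> ` T)"
    using inj\<phi> Fe by (simp add: bij_betw_def inj_on_def)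
  ultimately have iso: "isomorphic_matchings T (\<phi> ` T)"
    using mono unfolding isomorphic_matchings_def by blast
  have "disjnt d e" if "d \<in> T" "e \<in> \<phi> ` T" for d e
  proof -
    have "d \<in> M" "e \<in> M" "d \<noteq> e" using that TM disj by auto
    then show ?thesis using M by (simp add: ordered_matching_def pairwise_def)
  qed
  then have "\<Union>T \<inter> \<Union>(\<phi> ` T) = {}" unfolding disjnt_def by blast
  then have "twins M T (\<phi> ` T)" using TM iso by (simp add: twins_def)
  then show ?thesis using T(3) card_le_max_twins[OF finM] by (meson order_trans)
qed

theorem theorem1p2:
  fixes r :: nat
  assumes "r \<ge> 2"
  shows "\<exists>c::real. c > 0 \<and> (\<exists>n0::nat. \<forall>n\<ge>n0.
           real (min_max_twins r n) \<ge> c * real n powr (3 / 5 * (1 / (2 ^ (r - 1) - 1))))"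
proof -
  define c where "c = 1 / (8 * real (8 * r * twin_cost r) powr twin_exponent r)"
  have "twin_cost r > 0" using assms by (auto simp: twin_cost_def)
  then have "c > 0" using assms by (simp add: c_def)
  \<comment> \<open>The threshold is 2, the size from which \<open>many_twins\<close>
    applies.\<close>
  moreover have "c * real n powr twin_exponent r \<le> real (min_max_twins r n)" if "n \<ge> 2" for n
  proof -
    have "{max_twins M | M :: nat set set. ordered_matching r n M} \<noteq> {}"
      using ordered_matching_exists[of r n] assms by auto
    from Min_in[OF finite_max_twins_values this]
    obtain M :: "nat set set" where M: "ordered_matching r n M" "min_max_twins r n = max_twins M"
      unfolding min_max_twins_def by blast
    interpret matching_family r M "\<lambda>i e. sorted_list_of_set e ! i"
      by (rule matching_family_sorted[OF M(1)])
    have "card M = n" using M by (simp add: ordered_matching_def)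
    then obtain m where m: "has_twins M m" "c * real n powr twin_exponent r \<le> real m"
      using many_twins[OF assms order_refl] \<open>n \<ge> 2\<close> unfolding c_def by blast
    then show ?thesis using has_twins_le_max_twins[OF M(1) m(1)] M(2)
      by (simp add: order_trans[OF m(2)])
  qed
  ultimately show ?thesis unfolding twin_exponent_def by blast
qed

end
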